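(* When implemented with diagonal-norm $R^0$ SBP operators, the BR1, BR2 and SIPG SATs (coefficients listed in the context) are equivalent in the sense that they can be reproduced by considering $\sigma_1T^{(1)}_{\gamma k}$ and $\sigma_DT^{(D)}_\gamma$ in place of the coefficients $T^{(1)}_{\gamma k}$ and $T^{(D)}_\gamma$ of the BR1 SAT, for $\sigma_1,\sigma_D>0$. Similarly, the LDG and CDG SATs are equivalent for this family of operators.
   Context: **Setting.** A domain in $\mathbb R^2$ is partitioned into (possibly curved) triangles $\Omega_k$, each with $n_p$ volume nodes, and $n_f$ quadrature nodes on each facet. The diffusion operator $\nabla\cdot(\lambda\nabla\,\cdot)$, $\lambda$ symmetric positive definite (SPD), is discretized with a diagonal-norm summation-by-parts (SBP) operator: $H_k$ is the diagonal SPD norm matrix of $\Omega_k$, $D_{xk},D_{yk}$ the first-derivative matrices with $H_kD_{xk}+D_{xk}^TH_k=\sum_{\gamma}R_{\gamma k}^TB_\gamma N_{x\gamma k}R_{\gamma k}$ (similarly $y$), where $B_\gamma$ is the diagonal matrix of positive facet quadrature weights, $N_{x\gamma k},N_{y\gamma k}$ are diagonal matrices of outward unit normal components at facet nodes, and $R_{\gamma k}\in\mathbb R^{n_f\times n_p}$ is the extrapolation matrix from volume nodes to nodes of facet $\gamma$. $\Lambda_k$ is the $2\times2$ block matrix with diagonal blocks holding the entries of $\lambda$ at the volume nodes, $N_{\gamma k}=\begin{bmatrix}N_{x\gamma k}\\ N_{y\gamma k}\end{bmatrix}$, $\bar R_{\gamma k}=\mathrm{diag}(R_{\gamma k},R_{\gamma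 k})$, $\bar H_k=\mathrm{diag}(H_k,H_k)$, $D_{\gamma k}=N_{\gamma k}^T\bar R_{\gamma k}\Lambda_k\begin{bmatrix}D_{xk}\\ D_{yk}\end{bmatrix}$, and $$\Upsilon_{abk}=N_{ak}^T\bar R_{ak}\bar H_k^{-1}\Lambda_k\bar R_{bk}^TN_{bk}$$ for facets $a,b$ of $\Omega_k$. Facet weights $\alpha_{\gamma k}>0$ satisfy $\sum_{\gamma\subset\Gamma_k}\alpha_{\gamma k}=1$. **$R^0$ (SBP diagonal-E) family.** The facet quadrature nodes are collocated with volume nodes, and for facet number $n\in\{1,2,3\}$, $[R_{f_nk}]_{ij}=1$ if $i+(n-1)n_f=j$ and $0$ otherwise. **SATs (simultaneous approximation terms).** For interior facet $\gamma$ shared by $\Omega_k,\Omega_v$, with $\epsilon$ the other interior facets of $\Omega_k$ (neighbour $\Omega_g$) and $\delta$ those of $\Omega_v$ (neighbour $\Omega_q$), the interface SAT added to the discretization in $\Omega_k$ is $$\sum_{\gamma}[R_{\gamma k}^T\; D_{\gamma k}^T]\begin{bmatrix}T^{(1)}_{\gamma k}&T^{(3)}_{\gamma k}\\ T^{(2)}_{\gamma k}&T^{(4)}_{\gamma k}\end{bmatrix}\begin{bmatrix}R_{\gamma k}u_k-R_{\gamma v}u_v\\ D_{\gamma k}u_k+D_{\gamma v}u_v\end{bmatrix}+\sum_{\gamma}\Big\{\sum_{\epsilon}R_{\gamma k}^TT^{(5)}_{\gamma\epsilon k}[R_{\epsilon k}u_k-R_{\epsilon g}u_g]+\sum_{\delta}R_{\gamma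 k}^TT^{(6)}_{\gamma\delta v}[R_{\delta v}u_v-R_{\delta q}u_q]\Big\},$$ and on a Dirichlet facet the SAT is $[R_{\gamma k}^T\; D_{\gamma k}^T]\begin{bmatrix}T^{(D)}_\gamma\\ -B_\gamma\end{bmatrix}(R_{\gamma k}u_k-u_{\gamma k})$, with $u_{\gamma k}$ the Dirichlet data. All SATs below have $T^{(4)}=0$. - BR1: $T^{(1)}_{\gamma k}=T^{(1)}_{\gamma v}=\frac12B_\gamma[\frac1{\alpha_{\gamma k}}\Upsilon_{\gamma\gamma k}+\frac1{\alpha_{\gamma v}}\Upsilon_{\gamma\gamma v}]B_\gamma$, $T^{(2)}=-\frac12B_\gamma$, $T^{(3)}=\frac12B_\gamma$ (both sides), $T^{(5)}_{\gamma\epsilon k}=-T^{(6)}_{\gamma\epsilon k}=\frac1{16}B_\gamma\Upsilon_{\gamma\epsilon k}B_\epsilon$, $T^{(5)}_{\gamma\delta v}=-T^{(6)}_{\gamma\delta v}=\frac1{16}B_\gamma\Upsilon_{\gamma\delta v}B_\delta$, $T^{(D)}_\gamma=\frac1{\alpha_{\gamma k}}B_\gamma\Upsilon_{\gamma\gamma k}B_\gamma$. - BR2: as BR1 but $T^{(1)}_{\gamma k}=T^{(1)}_{\gamma v}=\frac14B_\gamma[\frac1{\alpha_{\gamma k}}\Upsilon_{\gamma\gamma k}+\frac1{\alpha_{\gamma v}}\Upsilon_{\gamma\gamma v}]B_\gamma$ and $T^{(5)}=T^{(6)}=0$. - SIPG: as BR2 but $T^{(1)}_{\gamma k}=T^{(1)}_{\gamma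 v}=\Big[\frac{(\lambda_{\max})_k\|B_\gamma^{1/2}R_{\gamma k}H_k^{-1/2}\|_2^2}{4\alpha_{\gamma k}}+\frac{(\lambda_{\max})_v\|B_\gamma^{1/2}R_{\gamma v}H_v^{-1/2}\|_2^2}{4\alpha_{\gamma v}}\Big]B_\gamma$ and $T^{(D)}_\gamma=\frac{(\lambda_{\max})_k}{\alpha_{\gamma k}}\|B_\gamma^{1/2}R_{\gamma k}H_k^{-1/2}\|_2^2B_\gamma$, where $(\lambda_{\max})_k$ is the largest eigenvalue of $\Lambda_k$. - LDG: with switches $\beta_{\gamma k},\beta_{\gamma v}\in\{0,1\}$, $\beta_{\gamma k}+\beta_{\gamma v}=1$ on each interior facet: $T^{(1)}_{\gamma k}=T^{(1)}_{\gamma v}=B_\gamma[\frac{\beta_{\gamma k}-\beta_{\gamma v}+1}{\alpha_{\gamma k}}\Upsilon_{\gamma\gamma k}+\frac{\beta_{\gamma v}-\beta_{\gamma k}+1}{\alpha_{\gamma v}}\Upsilon_{\gamma\gamma v}]B_\gamma$, $T^{(2)}_{\gamma k}=\frac{\beta_{\gamma v}-\beta_{\gamma k}-1}2B_\gamma$, $T^{(2)}_{\gamma v}=\frac{\beta_{\gamma k}-\beta_{\gamma v}-1}2B_\gamma$, $T^{(3)}_{\gamma k}=\frac{\beta_{\gamma v}-\beta_{\gamma k}+1}2B_\gamma$, $T^{(3)}_{\gamma v}=\frac{\beta_{\gamma k}-\beta_{\gamma v}+1}2B_\gamma$, $T^{(5)}_{\gamma\epsilon k}=-T^{(6)}_{\gamma\epsilon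 k}=\frac{[1+\beta_{\gamma k}-\beta_{\gamma v}][1+\beta_{\epsilon k}-\beta_{\epsilon g}]}{16}B_\gamma\Upsilon_{\gamma\epsilon k}B_\epsilon$, $T^{(6)}_{\gamma\delta v}=-T^{(5)}_{\gamma\delta v}=\frac{[\beta_{\gamma k}-\beta_{\gamma v}-1][1+\beta_{\delta v}-\beta_{\delta q}]}{16}B_\gamma\Upsilon_{\gamma\delta v}B_\delta$, $T^{(D)}_\gamma=\frac1{\alpha_{\gamma k}}B_\gamma\Upsilon_{\gamma\gamma k}B_\gamma$. - CDG: as LDG but with $T^{(1)}$ multiplied by $\frac12$ and $T^{(5)}=T^{(6)}=0$. Equivalence of LDG and CDG is in the same sense (equal up to positive scalings of $T^{(1)}$ and $T^{(D)}$).
   Formalization: For BR1 to SIPG, σ_1 and σ_D are positive diagonal matrices per facet, since positive scalars fail (e.g. if λ varies along a facet); they reduce to scalars where BΥ_γγ is constant along the facet for each adjacent element. *)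

theory Defs
  imports "Jordan_Normal_Form.Char_Poly"
begin

section \<open>Matrix preliminaries\<close>

definition spd :: "real mat \<Rightarrow> bool" where
  "spd A \<longleftrightarrow> A \<in> carrier_mat (dim_row A) (dim_row A) \<and> A\<^sup>T = A \<and>
     (\<forall>v \<in> carrier_vec (dim_row A). v \<noteq> 0\<^sub>v (dim_row A) \<longrightarrow> 0 < v \<bullet> (A *\<^sub>v v))"

definition pos_diag :: "nat \<Rightarrow> real mat \<Rightarrow> bool" where
  "pos_diag n A \<longleftrightarrow> A \<in> carrier_mat n n \<and> diagonal_mat A \<and> (\<forall>i<n. 0 < A $$ (i,i))"

text \<open>Function of a diagonal matrix; it is only applied to diagonal matrices with positive
  diagonal, to express inverses and (inverse) square roots.\<close>

definition diag_fun :: "(real \<Rightarrow> real) \<Rightarrow> real mat \<Rightarrow> real mat" where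
  "diag_fun f A = mat_diag (dim_row A) (\<lambda>i. f (A $$ (i,i)))"

definition diag2 :: "real mat \<Rightarrow> real mat" where
  "diag2 A = four_block_mat A (0\<^sub>m (dim_row A) (dim_col A)) (0\<^sub>m (dim_row A) (dim_col A)) A"

definition norm2 :: "real mat \<Rightarrow> real" where
  "norm2 A = (SUP v \<in> {v \<in> carrier_vec (dim_col A). v \<bullet> v = 1}. sqrt ((A *\<^sub>v v) \<bullet> (A *\<^sub>v v)))"

definition lambda_max :: "real mat \<Rightarrow> real" where
  "lambda_max A = Max {e. eigenvalue A e}"

definition vec_sum :: "nat \<Rightarrow> ('a \<Rightarrow> real vec) \<Rightarrow> 'a set \<Rightarrow> real vec" where
  "vec_sum n f S = vec n (\<lambda>i. \<Sum>s\<in>S. f s $ i)"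

definition mat_sum :: "nat \<Rightarrow> nat \<Rightarrow> ('a \<Rightarrow> real mat) \<Rightarrow> 'a set \<Rightarrow> real mat" where
  "mat_sum m n f S = mat m n (\<lambda>ij. \<Sum>s\<in>S. f s $$ ij)"


section \<open>Diagonal-norm SBP discretizations on a triangulation\<close>

text \<open>Elements have type \<open>'e\<close>, facets (edges of the triangulation) type \<open>'f\<close>;
  \<open>facet M k n\<close> is facet number \<open>n \<in> {1,2,3}\<close> of element \<open>k\<close>. The two triangles at an
  interior facet share the same facet object, so that \<open>B M \<gamma>\<close> is common to both, and
  \<open>R M \<gamma> k\<close>, \<open>R M \<gamma> v\<close> extrapolate to the same facet nodes in the same order.
  \<open>lam M k i\<close> is the \<open>2 \<times> 2\<close> diffusivity tensor at volume node \<open>i\<close> of element \<open>k\<close>.\<close>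

record ('e, 'f) disc =
  elems :: "'e set"
  facet :: "'e \<Rightarrow> nat \<Rightarrow> 'f"
  dirichlet :: "'f set"
  np :: nat
  nf :: nat
  H :: "'e \<Rightarrow> real mat"
  Dx :: "'e \<Rightarrow> real mat"
  Dy :: "'e \<Rightarrow> real mat"
  B :: "'f \<Rightarrow> real mat"
  R :: "'f \<Rightarrow> 'e \<Rightarrow> real mat"
  Nx :: "'f \<Rightarrow> 'e \<Rightarrow> real mat"
  Ny :: "'f \<Rightarrow> 'e \<Rightarrow> real mat"
  lam :: "'e \<Rightarrow> nat \<Rightarrow> real mat"
  alpha :: "'f \<Rightarrow> 'e \<Rightarrow> real"

definition facets :: "('e,'f) disc \<Rightarrow> 'e \<Rightarrow> 'f set" where
  "facets M k = facet M k ` {1,2,3}"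

definition adj :: "('e,'f) disc \<Rightarrow> 'f \<Rightarrow> 'e set" where
  "adj M \<gamma> = {k \<in> elems M. \<gamma> \<in> facets M k}"

definition int_facets :: "('e,'f) disc \<Rightarrow> 'e \<Rightarrow> 'f set" where
  "int_facets M k = {\<gamma> \<in> facets M k. card (adj M \<gamma>) = 2}"

definition dir_facets :: "('e,'f) disc \<Rightarrow> 'e \<Rightarrow> 'f set" where
  "dir_facets M k = facets M k \<inter> dirichlet M"

definition nbr :: "('e,'f) disc \<Rightarrow> 'f \<Rightarrow> 'e \<Rightarrow> 'e" where
  "nbr M \<gamma> k = (THE v. v \<in> adj M \<gamma> \<and> v \<noteq> k)"

definition sbp_discretization :: "('e,'f) disc \<Rightarrow> bool" where
  "sbp_discretization M \<longleftrightarrow>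
     finite (elems M) \<and> 0 < np M \<and> 0 < nf M \<and>
     (\<forall>k \<in> elems M. inj_on (facet M k) {1,2,3}) \<and>
     (\<forall>\<gamma>. card (adj M \<gamma>) \<le> 2) \<and>
     (\<forall>\<gamma> \<in> dirichlet M. card (adj M \<gamma>) = 1) \<and>
     (\<forall>k \<in> elems M.
        H M k \<in> carrier_mat (np M) (np M) \<and> diagonal_mat (H M k) \<and> spd (H M k) \<and>
        Dx M k \<in> carrier_mat (np M) (np M) \<and> Dy M k \<in> carrier_mat (np M) (np M) \<and>
        (\<forall>i < np M. lam M k i \<in> carrier_mat 2 2 \<and> spd (lam M k i)) \<and>
        (\<forall>\<gamma> \<in> facets M k.
           pos_diag (nf M) (B M \<gamma>) \<and>
           R M \<gamma> k \<in> carrier_mat (nf M) (np M) \<and>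
           Nx M \<gamma> k \<in> carrier_mat (nf M) (nf M) \<and> diagonal_mat (Nx M \<gamma> k) \<and>
           Ny M \<gamma> k \<in> carrier_mat (nf M) (nf M) \<and> diagonal_mat (Ny M \<gamma> k) \<and>
           (\<forall>i < nf M. (Nx M \<gamma> k $$ (i,i))\<^sup>2 + (Ny M \<gamma> k $$ (i,i))\<^sup>2 = 1) \<and>
           0 < alpha M \<gamma> k) \<and>
        (\<forall>\<gamma> \<in> int_facets M k. Nx M \<gamma> (nbr M \<gamma> k) = - Nx M \<gamma> k \<and>
                               Ny M \<gamma> (nbr M \<gamma> k) = - Ny M \<gamma> k) \<and>
        (\<Sum>\<gamma> \<in> facets M k. alpha M \<gamma> k) = 1 \<and>
        H M k * Dx M k + (Dx M k)\<^sup>T * H M k =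
          mat_sum (np M) (np M) (\<lambda>\<gamma>. (R M \<gamma> k)\<^sup>T * B M \<gamma> * Nx M \<gamma> k * R M \<gamma> k) (facets M k) \<and>
        H M k * Dy M k + (Dy M k)\<^sup>T * H M k =
          mat_sum (np M) (np M) (\<lambda>\<gamma>. (R M \<gamma> k)\<^sup>T * B M \<gamma> * Ny M \<gamma> k * R M \<gamma> k) (facets M k))"

text \<open>Matrix indices start at 0 here, so both \<open>i\<close> and \<open>j\<close> are shifted by one with
  respect to 1-based node numbers and the relation \<open>i + (n - 1) nf = j\<close> is unchanged. The bound
  \<open>3 nf \<le> np\<close> says that the volume nodes with which the facet nodes are collocated exist.\<close>

definition R0_family :: "('e,'f) disc \<Rightarrow> bool" where
  "R0_family M \<longleftrightarrow> 3 * nf M \<le> np M \<and>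
     (\<forall>k \<in> elems M. \<forall>n \<in> {1,2,3}. R M (facet M k n) k =
        mat (nf M) (np M) (\<lambda>(i,j). if i + (n - 1) * nf M = j then 1 else 0))"

definition Lambda :: "('e,'f) disc \<Rightarrow> 'e \<Rightarrow> real mat" where
  "Lambda M k =
     (let blk = (\<lambda>p q. mat_diag (np M) (\<lambda>i. lam M k i $$ (p,q)))
      in four_block_mat (blk 0 0) (blk 0 1) (blk 1 0) (blk 1 1))"

definition N :: "('e,'f) disc \<Rightarrow> 'f \<Rightarrow> 'e \<Rightarrow> real mat" where
  "N M \<gamma> k = Nx M \<gamma> k @\<^sub>r Ny M \<gamma> k"

definition Dn :: "('e,'f) disc \<Rightarrow> 'f \<Rightarrow> 'e \<Rightarrow> real mat" where
  "Dn M \<gamma> k = (N M \<gamma> k)\<^sup>T * diag2 (R M \<gamma> k) * Lambda M k * (Dx M k @\<^sub>r Dy M k)"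

definition Upsilon :: "('e,'f) disc \<Rightarrow> 'f \<Rightarrow> 'f \<Rightarrow> 'e \<Rightarrow> real mat" where
  "Upsilon M a b k =
     (N M a k)\<^sup>T * diag2 (R M a k) * diag_fun inverse (diag2 (H M k)) * Lambda M k *
     (diag2 (R M b k))\<^sup>T * N M b k"


section \<open>Simultaneous approximation terms\<close>

record ('e, 'f) sat =
  T1 :: "'f \<Rightarrow> 'e \<Rightarrow> real mat"
  T2 :: "'f \<Rightarrow> 'e \<Rightarrow> real mat"
  T3 :: "'f \<Rightarrow> 'e \<Rightarrow> real mat"
  T4 :: "'f \<Rightarrow> 'e \<Rightarrow> real mat"
  T5 :: "'f \<Rightarrow> 'f \<Rightarrow> 'e \<Rightarrow> real mat"
  T6 :: "'f \<Rightarrow> 'f \<Rightarrow> 'e \<Rightarrow> real mat"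
  TD :: "'f \<Rightarrow> 'e \<Rightarrow> real mat"

definition jump :: "('e,'f) disc \<Rightarrow> ('e \<Rightarrow> real vec) \<Rightarrow> 'f \<Rightarrow> 'e \<Rightarrow> real vec" where
  "jump M u \<gamma> k = R M \<gamma> k *\<^sub>v u k - R M \<gamma> (nbr M \<gamma> k) *\<^sub>v u (nbr M \<gamma> k)"

definition flux_jump :: "('e,'f) disc \<Rightarrow> ('e \<Rightarrow> real vec) \<Rightarrow> 'f \<Rightarrow> 'e \<Rightarrow> real vec" where
  "flux_jump M u \<gamma> k = Dn M \<gamma> k *\<^sub>v u k + Dn M \<gamma> (nbr M \<gamma> k) *\<^sub>v u (nbr M \<gamma> k)"

definition interface_SAT ::
  "('e,'f) disc \<Rightarrow> ('e,'f) sat \<Rightarrow> ('e \<Rightarrow> real vec) \<Rightarrow> 'e \<Rightarrow> real vec" where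
  "interface_SAT M C u k =
     vec_sum (np M) (\<lambda>\<gamma>.
       ((R M \<gamma> k @\<^sub>r Dn M \<gamma> k)\<^sup>T *
         four_block_mat (T1 C \<gamma> k) (T3 C \<gamma> k) (T2 C \<gamma> k) (T4 C \<gamma> k)) *\<^sub>v
         (jump M u \<gamma> k @\<^sub>v flux_jump M u \<gamma> k)) (int_facets M k)
   + vec_sum (np M) (\<lambda>\<gamma>. let v = nbr M \<gamma> k in
         vec_sum (np M) (\<lambda>\<epsilon>. ((R M \<gamma> k)\<^sup>T * T5 C \<gamma> \<epsilon> k) *\<^sub>v jump M u \<epsilon> k) (int_facets M k - {\<gamma>})
       + vec_sum (np M) (\<lambda>\<delta>. ((R M \<gamma> k)\<^sup>T * T6 C \<gamma> \<delta> v) *\<^sub>v jump M u \<delta> v) (int_facets M v - {\<gamma>}))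
       (int_facets M k)"

definition dirichlet_SAT ::
  "('e,'f) disc \<Rightarrow> ('e,'f) sat \<Rightarrow> ('e \<Rightarrow> real vec) \<Rightarrow> ('f \<Rightarrow> real vec) \<Rightarrow> 'e \<Rightarrow> real vec" where
  "dirichlet_SAT M C u g k =
     vec_sum (np M) (\<lambda>\<gamma>.
       ((R M \<gamma> k @\<^sub>r Dn M \<gamma> k)\<^sup>T * (TD C \<gamma> k @\<^sub>r (- B M \<gamma>))) *\<^sub>v (R M \<gamma> k *\<^sub>v u k - g \<gamma>))
       (dir_facets M k)"

definition SAT ::
  "('e,'f) disc \<Rightarrow> ('e,'f) sat \<Rightarrow> ('e \<Rightarrow> real vec) \<Rightarrow> ('f \<Rightarrow> real vec) \<Rightarrow> 'e \<Rightarrow> real vec" where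
  "SAT M C u g k = interface_SAT M C u k + dirichlet_SAT M C u g k"

text \<open>In \<open>T6 \<gamma> \<delta> v\<close> below, \<open>\<gamma>\<close> and \<open>\<delta>\<close> are facets of \<open>v\<close>; the term is used by the neighbour
  \<open>k = nbr M \<gamma> v\<close> of \<open>v\<close> across \<open>\<gamma>\<close>.\<close>

definition BR1 :: "('e,'f) disc \<Rightarrow> ('e,'f) sat" where
  "BR1 M = \<lparr>
     T1 = (\<lambda>\<gamma> k. let v = nbr M \<gamma> k in
       (1/2) \<cdot>\<^sub>m (B M \<gamma> * ((1 / alpha M \<gamma> k) \<cdot>\<^sub>m Upsilon M \<gamma> \<gamma> k
                          + (1 / alpha M \<gamma> v) \<cdot>\<^sub>m Upsilon M \<gamma> \<gamma> v) * B M \<gamma>)),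
     T2 = (\<lambda>\<gamma> k. (-1/2) \<cdot>\<^sub>m B M \<gamma>),
     T3 = (\<lambda>\<gamma> k. (1/2) \<cdot>\<^sub>m B M \<gamma>),
     T4 = (\<lambda>\<gamma> k. 0\<^sub>m (nf M) (nf M)),
     T5 = (\<lambda>\<gamma> \<epsilon> k. (1/16) \<cdot>\<^sub>m (B M \<gamma> * Upsilon M \<gamma> \<epsilon> k * B M \<epsilon>)),
     T6 = (\<lambda>\<gamma> \<delta> v. (-1/16) \<cdot>\<^sub>m (B M \<gamma> * Upsilon M \<gamma> \<delta> v * B M \<delta>)),
     TD = (\<lambda>\<gamma> k. (1 / alpha M \<gamma> k) \<cdot>\<^sub>m (B M \<gamma> * Upsilon M \<gamma> \<gamma> k * B M \<gamma>)) \<rparr>"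

definition BR2 :: "('e,'f) disc \<Rightarrow> ('e,'f) sat" where
  "BR2 M = (BR1 M)\<lparr>
     T1 := (\<lambda>\<gamma> k. let v = nbr M \<gamma> k in
       (1/4) \<cdot>\<^sub>m (B M \<gamma> * ((1 / alpha M \<gamma> k) \<cdot>\<^sub>m Upsilon M \<gamma> \<gamma> k
                          + (1 / alpha M \<gamma> v) \<cdot>\<^sub>m Upsilon M \<gamma> \<gamma> v) * B M \<gamma>)),
     T5 := (\<lambda>\<gamma> \<epsilon> k. 0\<^sub>m (nf M) (nf M)),
     T6 := (\<lambda>\<gamma> \<delta> v. 0\<^sub>m (nf M) (nf M)) \<rparr>"

definition trace_const :: "('e,'f) disc \<Rightarrow> 'f \<Rightarrow> 'e \<Rightarrow> real" where
  "trace_const M \<gamma> k =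
     (norm2 (diag_fun sqrt (B M \<gamma>) * R M \<gamma> k * diag_fun (\<lambda>x. inverse (sqrt x)) (H M k)))\<^sup>2"

definition SIPG :: "('e,'f) disc \<Rightarrow> ('e,'f) sat" where
  "SIPG M = (BR2 M)\<lparr>
     T1 := (\<lambda>\<gamma> k. let v = nbr M \<gamma> k in
       (lambda_max (Lambda M k) * trace_const M \<gamma> k / (4 * alpha M \<gamma> k)
        + lambda_max (Lambda M v) * trace_const M \<gamma> v / (4 * alpha M \<gamma> v)) \<cdot>\<^sub>m B M \<gamma>),
     TD := (\<lambda>\<gamma> k. (lambda_max (Lambda M k) / alpha M \<gamma> k * trace_const M \<gamma> k) \<cdot>\<^sub>m B M \<gamma>) \<rparr>"

definition switch :: "('e,'f) disc \<Rightarrow> ('f \<Rightarrow> 'e \<Rightarrow> real) \<Rightarrow> bool" where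
  "switch M \<beta> \<longleftrightarrow> (\<forall>k \<in> elems M. \<forall>\<gamma> \<in> int_facets M k.
     \<beta> \<gamma> k \<in> {0,1} \<and> \<beta> \<gamma> k + \<beta> \<gamma> (nbr M \<gamma> k) = 1)"

definition LDG :: "('e,'f) disc \<Rightarrow> ('f \<Rightarrow> 'e \<Rightarrow> real) \<Rightarrow> ('e,'f) sat" where
  "LDG M \<beta> = \<lparr>
     T1 = (\<lambda>\<gamma> k. let v = nbr M \<gamma> k in
       B M \<gamma> * (((\<beta> \<gamma> k - \<beta> \<gamma> v + 1) / alpha M \<gamma> k) \<cdot>\<^sub>m Upsilon M \<gamma> \<gamma> k
               + ((\<beta> \<gamma> v - \<beta> \<gamma> k + 1) / alpha M \<gamma> v) \<cdot>\<^sub>m Upsilon M \<gamma> \<gamma> v) * B M \<gamma>),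
     T2 = (\<lambda>\<gamma> k. let v = nbr M \<gamma> k in ((\<beta> \<gamma> v - \<beta> \<gamma> k - 1) / 2) \<cdot>\<^sub>m B M \<gamma>),
     T3 = (\<lambda>\<gamma> k. let v = nbr M \<gamma> k in ((\<beta> \<gamma> v - \<beta> \<gamma> k + 1) / 2) \<cdot>\<^sub>m B M \<gamma>),
     T4 = (\<lambda>\<gamma> k. 0\<^sub>m (nf M) (nf M)),
     T5 = (\<lambda>\<gamma> \<epsilon> k. let v = nbr M \<gamma> k; g = nbr M \<epsilon> k in
       ((1 + \<beta> \<gamma> k - \<beta> \<gamma> v) * (1 + \<beta> \<epsilon> k - \<beta> \<epsilon> g) / 16) \<cdot>\<^sub>m
         (B M \<gamma> * Upsilon M \<gamma> \<epsilon> k * B M \<epsilon>)),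
     T6 = (\<lambda>\<gamma> \<delta> v. let k = nbr M \<gamma> v; q = nbr M \<delta> v in
       ((\<beta> \<gamma> k - \<beta> \<gamma> v - 1) * (1 + \<beta> \<delta> v - \<beta> \<delta> q) / 16) \<cdot>\<^sub>m
         (B M \<gamma> * Upsilon M \<gamma> \<delta> v * B M \<delta>)),
     TD = (\<lambda>\<gamma> k. (1 / alpha M \<gamma> k) \<cdot>\<^sub>m (B M \<gamma> * Upsilon M \<gamma> \<gamma> k * B M \<gamma>)) \<rparr>"

definition CDG :: "('e,'f) disc \<Rightarrow> ('f \<Rightarrow> 'e \<Rightarrow> real) \<Rightarrow> ('e,'f) sat" where
  "CDG M \<beta> = (LDG M \<beta>)\<lparr>
     T1 := (\<lambda>\<gamma> k. (1/2) \<cdot>\<^sub>m T1 (LDG M \<beta>) \<gamma> k),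
     T5 := (\<lambda>\<gamma> \<epsilon> k. 0\<^sub>m (nf M) (nf M)),
     T6 := (\<lambda>\<gamma> \<delta> v. 0\<^sub>m (nf M) (nf M)) \<rparr>"


section \<open>Equivalence up to positive scalings\<close>

text \<open>The scaling factors are matrices: a scalar factor \<open>s\<close> is \<open>s \<cdot>\<^sub>m 1\<^sub>m nf\<close>, and a positive
  diagonal matrix scales facet node by facet node. Uniform scalars relate BR1 to BR2 and LDG to
  CDG, but not in general BR1 to SIPG: the diagonal of \<open>B * Upsilon M \<gamma> \<gamma> k * B\<close> varies from
  node to node differently from that of \<open>B\<close>, for instance if the diffusivity varies along
  \<open>\<gamma>\<close>.\<close>

definition scale_SAT ::
  "('f \<Rightarrow> real mat) \<Rightarrow> ('f \<Rightarrow> real mat) \<Rightarrow> ('e,'f) sat \<Rightarrow> ('e,'f) sat" where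
  "scale_SAT \<sigma>1 \<sigma>D C =
     C\<lparr>T1 := (\<lambda>\<gamma> k. \<sigma>1 \<gamma> * T1 C \<gamma> k), TD := (\<lambda>\<gamma> k. \<sigma>D \<gamma> * TD C \<gamma> k)\<rparr>"

text \<open>Two sets of coefficients give the same SAT if they agree wherever a SAT uses them and the
  resulting terms agree in every element, for every grid function and all Dirichlet data.\<close>

definition same_SAT :: "('e,'f) disc \<Rightarrow> ('e,'f) sat \<Rightarrow> ('e,'f) sat \<Rightarrow> bool" where
  "same_SAT M C C' \<longleftrightarrow>
     (\<forall>k \<in> elems M. \<forall>\<gamma> \<in> int_facets M k.
        T1 C \<gamma> k = T1 C' \<gamma> k \<and> T2 C \<gamma> k = T2 C' \<gamma> k \<and>
        T3 C \<gamma> k = T3 C' \<gamma> k \<and> T4 C \<gamma> k = T4 C' \<gamma> k \<and>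
        (\<forall>\<epsilon> \<in> int_facets M k - {\<gamma>}. T5 C \<gamma> \<epsilon> k = T5 C' \<gamma> \<epsilon> k \<and> T6 C \<gamma> \<epsilon> k = T6 C' \<gamma> \<epsilon> k)) \<and>
     (\<forall>k \<in> elems M. \<forall>\<gamma> \<in> dir_facets M k. TD C \<gamma> k = TD C' \<gamma> k) \<and>
     (\<forall>u g. (\<forall>k \<in> elems M. u k \<in> carrier_vec (np M)) \<longrightarrow>
            (\<forall>\<gamma> \<in> dirichlet M. g \<gamma> \<in> carrier_vec (nf M)) \<longrightarrow>
            (\<forall>k \<in> elems M. SAT M C u g k = SAT M C' u g k))"

end

theory Submission
  imports Defs
begin

text \<open>For an \<open>R\<^sup>0\<close> operator, \<open>R\<^sup>T N\<close> only meets the volume nodes collocated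
  with the facet, and different facets of an element use different volume nodes. As
  \<open>H\<^sup>-\<^sup>1 \<Lambda>\<close> couples no two nodes, \<open>\<Upsilon>\<close> vanishes for two different facets, so the extended
  terms of BR1 and LDG drop out. For a single facet it is diagonal with the positive entries
  \<open>n\<^sup>T \<lambda> n / H\<close>, so \<open>B \<Upsilon> B\<close> and the SIPG coefficient, a positive multiple of \<open>B\<close>, differ by
  a positive diagonal factor.\<close>

section \<open>Block matrices and a four-term form of \<Upsilon>\<close>

text \<open>A stacked pair is a block matrix with empty right-hand blocks, so block multiplication
  applies twice; the empty blocks are discarded at the end. This sandwich is the shape of
  \<Upsilon>.\<close>

lemma append_rows_transpose_mult_four_block_mult_append_rows:
  fixes A1 :: "'a :: comm_semiring_0 mat"
  assumes A: "A1 \<in> carrier_mat n r" "A2 \<in> carrier_mat n r"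
    and C: "C11 \<in> carrier_mat n n" "C12 \<in> carrier_mat n n"
      "C21 \<in> carrier_mat n n" "C22 \<in> carrier_mat n n"
    and B: "B1 \<in> carrier_mat n s" "B2 \<in> carrier_mat n s"
  shows "(A1 @\<^sub>r A2)\<^sup>T * four_block_mat C11 C12 C21 C22 * (B1 @\<^sub>r B2)
    = A1\<^sup>T * C11 * B1 + A2\<^sup>T * C21 * B1 + (A1\<^sup>T * C12 * B2 + A2\<^sup>T * C22 * B2)"
proof -
  have "(A1 @\<^sub>r A2)\<^sup>T = four_block_mat A1\<^sup>T A2\<^sup>T (0\<^sub>m 0 n) (0\<^sub>m 0 n)"
    unfolding append_rows_def using A by (subst transpose_four_block_mat[of _ n r _ 0 _ n]) auto
  then have "(A1 @\<^sub>r A2)\<^sup>T * four_block_mat C11 C12 C21 C22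
    = four_block_mat (A1\<^sup>T * C11 + A2\<^sup>T * C21) (A1\<^sup>T * C12 + A2\<^sup>T * C22) (0\<^sub>m 0 n) (0\<^sub>m 0 n)"
    using A C by (simp only:) (subst mult_four_block_mat[of _ r n _ n _ 0 _ _ n _ n]; auto)
  then have "(A1 @\<^sub>r A2)\<^sup>T * four_block_mat C11 C12 C21 C22 * (B1 @\<^sub>r B2)
    = four_block_mat ((A1\<^sup>T * C11 + A2\<^sup>T * C21) * B1 + (A1\<^sup>T * C12 + A2\<^sup>T * C22) * B2)
        (0\<^sub>m r 0) (0\<^sub>m 0 s) (0\<^sub>m 0 0)"
    unfolding append_rows_def using A B C
    by simp (subst mult_four_block_mat[of _ r n _ n _ 0 _ _ s _ 0]; auto intro!: cong_four_block_mat)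
  also have "\<dots> = (A1\<^sup>T * C11 + A2\<^sup>T * C21) * B1 + (A1\<^sup>T * C12 + A2\<^sup>T * C22) * B2"
    by (rule eq_matI) (use A B C in auto)
  also have "\<dots> = A1\<^sup>T * C11 * B1 + A2\<^sup>T * C21 * B1 + (A1\<^sup>T * C12 * B2 + A2\<^sup>T * C22 * B2)"
    using A B C by (simp add: add_mult_distrib_mat[of _ r n _ _ s])
  finally show ?thesis .
qed

lemma diag2_carrier [simp]: "A \<in> carrier_mat m n \<Longrightarrow> diag2 A \<in> carrier_mat (m + m) (n + n)"
  by (simp add: diag2_def)

lemma transpose_diag2: "(diag2 A)\<^sup>T = diag2 A\<^sup>T"
  unfolding diag2_def
  by (subst transpose_four_block_mat[of _ "dim_row A" "dim_col A" _ "dim_col A" _ "dim_row A"]) auto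

lemma diag2_mult_append_rows:
  assumes "A \<in> carrier_mat m n" "X \<in> carrier_mat n c" "Y \<in> carrier_mat n c"
  shows "diag2 A * (X @\<^sub>r Y) = (A * X) @\<^sub>r (A * Y)"
  unfolding diag2_def append_rows_def using assms
  by (subst mult_four_block_mat[of _ m n _ n _ m _ _ c _ 0]; auto intro!: cong_four_block_mat)

lemma diag2_mult_four_block:
  assumes "A \<in> carrier_mat n n" "C11 \<in> carrier_mat n n" "C12 \<in> carrier_mat n n"
      "C21 \<in> carrier_mat n n" "C22 \<in> carrier_mat n n"
  shows "diag2 A * four_block_mat C11 C12 C21 C22
    = four_block_mat (A * C11) (A * C12) (A * C21) (A * C22)"
  unfolding diag2_def using assms
  by (subst mult_four_block_mat[of _ n n _ n _ n _ _ n _ n]; auto intro!: cong_four_block_mat)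

lemma diag_fun_diag2:
  assumes "A \<in> carrier_mat n n"
  shows "diag_fun f (diag2 A) = diag2 (mat_diag n (\<lambda>i. f (A $$ (i,i))))"
  unfolding diag2_def diag_fun_def mat_diag_def
  by (rule eq_matI) (use assms in auto)

lemma Lambda_carrier [simp]: "Lambda M k \<in> carrier_mat (np M + np M) (np M + np M)"
  by (simp add: Lambda_def Let_def)

text \<open>The bracketing used for \<Upsilon>: it isolates the product of inverse norm and
  diffusivity in the middle and gathers the facet data on either side.\<close>

lemma mult_mat_assoc5:
  fixes P :: "'a :: semiring_0 mat"
  assumes "P \<in> carrier_mat n1 n2" "G \<in> carrier_mat n2 n3" "L \<in> carrier_mat n3 n4"
    "D \<in> carrier_mat n4 n5" "S \<in> carrier_mat n5 n6"
  shows "P * G * L * D * S = P * (G * L) * (D * S)"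
  using assms by (simp add: assoc_mult_mat[of P n1 n2 G n3 L n4]
      assoc_mult_mat[of "P * (G * L)" n1 n4 D n5 S n6])

text \<open>Both outer factors come from stacking \<open>R\<^sup>T * Nx\<close> over
  \<open>R\<^sup>T * Ny\<close>, and the product of inverse norm and diffusivity consists of four
  diagonal blocks \<open>C p q\<close>. Each pair of components contributes one term.\<close>

lemma Upsilon_eq:
  fixes M :: "('e, 'f) disc"
  assumes Hk: "H M k \<in> carrier_mat (np M) (np M)"
    and Ra: "R M a k \<in> carrier_mat (nf M) (np M)" and Rb: "R M b k \<in> carrier_mat (nf M) (np M)"
    and Na: "Nx M a k \<in> carrier_mat (nf M) (nf M)" "Ny M a k \<in> carrier_mat (nf M) (nf M)"
    and Nb: "Nx M b k \<in> carrier_mat (nf M) (nf M)" "Ny M b k \<in> carrier_mat (nf M) (nf M)"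
  defines "C \<equiv> \<lambda>p q. mat_diag (np M) (\<lambda>i. inverse (H M k $$ (i,i)) * lam M k i $$ (p,q))"
  shows "Upsilon M a b k
    = ((R M a k)\<^sup>T * Nx M a k)\<^sup>T * C 0 0 * ((R M b k)\<^sup>T * Nx M b k) + ((R M a k)\<^sup>T * Ny M a k)\<^sup>T * C 1 0 * ((R M b k)\<^sup>T * Nx M b k)
    + (((R M a k)\<^sup>T * Nx M a k)\<^sup>T * C 0 1 * ((R M b k)\<^sup>T * Ny M b k) + ((R M a k)\<^sup>T * Ny M a k)\<^sup>T * C 1 1 * ((R M b k)\<^sup>T * Ny M b k))"
proof -
  let ?P = "\<lambda>c. ((R M c k)\<^sup>T * Nx M c k) @\<^sub>r ((R M c k)\<^sup>T * Ny M c k)"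
  let ?G = "diag_fun inverse (diag2 (H M k))"
  have P: "(diag2 (R M a k))\<^sup>T * N M a k = ?P a" "(diag2 (R M b k))\<^sup>T * N M b k = ?P b"
    unfolding N_def transpose_diag2 using Ra Rb Na Nb
    by (auto intro!: diag2_mult_append_rows)
  have Nc: "N M a k \<in> carrier_mat (nf M + nf M) (nf M)" "N M b k \<in> carrier_mat (nf M + nf M) (nf M)"
    using Na Nb by (auto simp: N_def)
  \<comment> \<open>The left factor is the transpose of \<open>diag2 R\<^sup>T * N\<close> for facet
    \<open>a\<close>, so the same stacked form serves both sides.\<close>
  have PaT: "(N M a k)\<^sup>T * diag2 (R M a k) = (?P a)\<^sup>T"
    unfolding P[symmetric] using Nc Ra
    by (subst transpose_mult[of _ "np M + np M" "nf M + nf M" _ "nf M"]) auto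
  have G: "?G * Lambda M k = four_block_mat (C 0 0) (C 0 1) (C 1 0) (C 1 1)"
    unfolding diag_fun_diag2[OF Hk] Lambda_def Let_def
    by (subst diag2_mult_four_block[of _ "np M"]) (auto simp: C_def)
  have Gc: "?G \<in> carrier_mat (np M + np M) (np M + np M)"
    unfolding diag_fun_diag2[OF Hk] by simp
  have Pc: "?P a \<in> carrier_mat (np M + np M) (nf M)"
    using Ra Na by (intro carrier_append_rows) auto
  have "Upsilon M a b k = (?P a)\<^sup>T * (?G * Lambda M k) * ?P b"
    unfolding Upsilon_def PaT P(2)[symmetric]
    using transpose_carrier_mat[THEN iffD2, OF Pc] Gc Lambda_carrier[of M k] Rb Nc(2)
    by (intro mult_mat_assoc5[of _ "nf M" "np M + np M" _ "np M + np M" _ "np M + np M"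
          _ "nf M + nf M" _ "nf M"]) auto
  also have "\<dots> = ((R M a k)\<^sup>T * Nx M a k)\<^sup>T * C 0 0 * ((R M b k)\<^sup>T * Nx M b k) + ((R M a k)\<^sup>T * Ny M a k)\<^sup>T * C 1 0 * ((R M b k)\<^sup>T * Nx M b k)
    + (((R M a k)\<^sup>T * Nx M a k)\<^sup>T * C 0 1 * ((R M b k)\<^sup>T * Ny M b k) + ((R M a k)\<^sup>T * Ny M a k)\<^sup>T * C 1 1 * ((R M b k)\<^sup>T * Ny M b k))"
    unfolding G using Ra Rb Na Nb
    by (intro append_rows_transpose_mult_four_block_mult_append_rows) (auto simp: C_def)
  finally show ?thesis .
qed

section \<open>Shifted diagonal matrices\<close>

lemma diagonal_mat_eq_mat_diag:
  assumes "A \<in> carrier_mat n n" "diagonal_mat A"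
  shows "A = mat_diag n (\<lambda>i. A $$ (i,i))"
  by (rule eq_matI) (use assms in \<open>auto simp: diagonal_mat_def mat_diag_def\<close>)

text \<open>The shape of \<open>R\<^sup>T\<close> times a diagonal matrix for a collocated facet:
  facet node \<open>i\<close> carries \<open>f i\<close> at volume node \<open>i + s\<close>, where
  \<open>s\<close> is the offset of the facet's nodes.\<close>

definition place :: "nat \<Rightarrow> nat \<Rightarrow> nat \<Rightarrow> (nat \<Rightarrow> real) \<Rightarrow> real mat" where
  "place m n s f = mat m n (\<lambda>(j,i). if i + s = j then f i else 0)"

text \<open>Column \<open>i\<close> of the left \<open>place\<close> sits at node
  \<open>i + s\<close> and column \<open>l\<close> of the right one at \<open>l + t\<close>. The sum
  over volume nodes therefore keeps at most one term, and only if these nodes coincide. The bounds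
  say that all these nodes exist.\<close>

lemma place_sandwich:
  assumes "n + s \<le> m" "n + t \<le> m"
  shows "(place m n s f)\<^sup>T * mat_diag m c * place m n t g
    = mat n n (\<lambda>(i,l). if i + s = l + t then f i * c (i + s) * g l else 0)"
proof -
  have "(place m n s f)\<^sup>T * mat_diag m c = mat n m (\<lambda>(i,j). if i + s = j then f i * c j else 0)"
    by (subst mat_diag_mult_right[of _ n]) (auto simp: place_def)
  then have "(place m n s f)\<^sup>T * mat_diag m c * place m n t g
    = mat n m (\<lambda>(i,j). if i + s = j then f i * c j else 0) * place m n t g" by simp
  also have "\<dots> = mat n n (\<lambda>(i,l). if i + s = l + t then f i * c (i + s) * g l else 0)"
  proof (rule eq_matI, goal_cases)
    case (1 i l)
    then have il: "i < n" "l < n" by auto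
    have "(\<Sum>j\<in>{0..<m}. (if i + s = j then f i * c j else 0) * (if l + t = j then g l else 0))
      = (\<Sum>j\<in>{0..<m}. if j = i + s then (if i + s = l + t then f i * c (i + s) * g l else 0) else 0)"
      by (intro sum.cong) auto
    also have "\<dots> = (if i + s = l + t then f i * c (i + s) * g l else 0)"
      using assms \<open>i < n\<close> by (subst sum.delta) auto
    finally show ?case
      using il by (simp add: scalar_prod_def place_def)
  qed (auto simp: place_def)
  finally show ?thesis .
qed

lemma place_selection:
  assumes "D \<in> carrier_mat n n" "diagonal_mat D"
  shows "(mat n m (\<lambda>(i,j). if i + s = j then 1 else 0))\<^sup>T * D = place m n s (\<lambda>i. D $$ (i,i))"
  by (subst diagonal_mat_eq_mat_diag[OF assms], subst mat_diag_mult_right[of _ m])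
    (auto simp: place_def)

section \<open>Positivity of the tensor, the largest eigenvalue and the spectral norm\<close>

text \<open>The explicit quadratic form is applied twice: to facet normals, for the diagonal of
  \<Upsilon>, and to the pair of entries of an eigenvector at one node, for
  \<open>lambda_max\<close>.\<close>

lemma spd_2x2:
  assumes "spd A" "A \<in> carrier_mat 2 2"
  shows "A $$ (1,0) = A $$ (0,1)"
    and "x \<noteq> 0 \<or> y \<noteq> 0 \<Longrightarrow> 0 < A $$ (0,0) * x\<^sup>2 + 2 * A $$ (0,1) * x * y + A $$ (1,1) * y\<^sup>2"
proof -
  have "A\<^sup>T $$ (0,1) = A $$ (0,1)" using assms by (simp add: spd_def)
  then show sym: "A $$ (1,0) = A $$ (0,1)" using assms by simp
  define w where "w = vec 2 (\<lambda>i. if i = 0 then x else y)"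
  assume "x \<noteq> 0 \<or> y \<noteq> 0"
  then have "w $ 0 \<noteq> 0 \<or> w $ 1 \<noteq> 0" by (simp add: w_def)
  then have "w \<noteq> 0\<^sub>v 2" by auto
  then have "0 < w \<bullet> (A *\<^sub>v w)" using assms by (auto simp: spd_def w_def)
  also have "w \<bullet> (A *\<^sub>v w) = A $$ (0,0) * x\<^sup>2 + 2 * A $$ (0,1) * x * y + A $$ (1,1) * y\<^sup>2"
    using assms(2) sym
    by (auto simp: scalar_prod_def w_def power2_eq_square algebra_simps numeral_2_eq_2)
  finally show "0 < A $$ (0,0) * x\<^sup>2 + 2 * A $$ (0,1) * x * y + A $$ (1,1) * y\<^sup>2" .
qed

text \<open>All four blocks are diagonal, so \<open>Lambda M k\<close> acts on the pair of entries
  at each node separately, through the tensor at that node. This reduces its eigenvalues to those of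
  2 by 2 matrices.\<close>

lemma Lambda_mult_vec:
  assumes "x \<in> carrier_vec (np M)" "y \<in> carrier_vec (np M)"
  shows "Lambda M k *\<^sub>v (x @\<^sub>v y)
    = vec (np M) (\<lambda>i. lam M k i $$ (0,0) * x $ i + lam M k i $$ (0,1) * y $ i)
      @\<^sub>v vec (np M) (\<lambda>i. lam M k i $$ (1,0) * x $ i + lam M k i $$ (1,1) * y $ i)"
proof -
  have diag: "mat_diag (np M) c *\<^sub>v z = vec (np M) (\<lambda>i. c i * z $ i)"
    if "z \<in> carrier_vec (np M)" for z and c :: "nat \<Rightarrow> real"
  proof (rule eq_vecI)
    fix i assume "i < dim_vec (vec (np M) (\<lambda>i. c i * z $ i))"
    then have i: "i < np M" by simp
    have "(\<Sum>j\<in>{0..<np M}. (if i = j then c j else 0) * z $ j)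
      = (\<Sum>j\<in>{0..<np M}. if j = i then c i * z $ i else 0)" by (intro sum.cong) auto
    then show "(mat_diag (np M) c *\<^sub>v z) $ i = vec (np M) (\<lambda>i. c i * z $ i) $ i"
      using i that by (simp add: mat_diag_def scalar_prod_def)
  qed (use that in \<open>auto simp: mat_diag_def\<close>)
  show ?thesis
    unfolding Lambda_def Let_def
    by (subst four_block_mat_mult_vec[of _ "np M" "np M" _ "np M" _ "np M"])
      (use assms in \<open>auto simp: diag intro!: eq_vecI\<close>)
qed

lemma eigenvalue_2x2_ex:
  fixes a b c :: real
  shows "\<exists>e x y. (x \<noteq> 0 \<or> y \<noteq> 0) \<and> a * x + b * y = e * x \<and> b * x + c * y = e * y"
proof (cases "b = 0")
  case True
  then have "((1::real) \<noteq> 0 \<or> (0::real) \<noteq> 0) \<and> a * 1 + b * 0 = a * 1 \<and> b * 1 + c * 0 = a * 0" by simp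
  then show ?thesis by blast
next
  case False
  \<comment> \<open>\<open>e\<close> is the larger root of the characteristic polynomial, real since
    the radicand is a sum of squares; \<open>(b, e - a)\<close> is an eigenvector, nonzero because
    \<open>b\<close> is.\<close>
  define r where "r = sqrt (((a - c) / 2)\<^sup>2 + b\<^sup>2)"
  define e where "e = (a + c) / 2 + r"
  have "r\<^sup>2 = ((a - c) / 2)\<^sup>2 + b\<^sup>2" by (simp add: r_def)
  then have "b * b + c * (e - a) = e * (e - a)"
    by (simp add: e_def power2_eq_square field_simps)
  moreover have "a * b + b * (e - a) = e * b" by (simp add: algebra_simps)
  ultimately show ?thesis using False by blast
qed

text \<open>\<open>Max\<close> is an element of its set only if the set is finite and nonempty. So
  three facts are shown: the eigenvalues, as roots of the characteristic polynomial, are finitely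
  many; each is positive; and at least one real eigenvalue exists.\<close>

lemma lambda_max_Lambda_pos:
  fixes M :: "('e, 'f) disc"
  assumes "0 < np M" and lam: "\<And>i. i < np M \<Longrightarrow> lam M k i \<in> carrier_mat 2 2 \<and> spd (lam M k i)"
  shows "0 < lambda_max (Lambda M k)"
proof -
  let ?L = "Lambda M k" and ?n = "np M"
  have dim: "dim_row ?L = ?n + ?n" by (rule carrier_matD(1)[OF Lambda_carrier])
  have fin: "finite {e. eigenvalue ?L e}"
  proof -
    have "char_poly ?L \<noteq> 0" using degree_monic_char_poly[OF Lambda_carrier, of M k] by auto
    then show ?thesis
      using poly_roots_finite[of "char_poly ?L"] by (simp add: eigenvalue_root_char_poly[OF Lambda_carrier])
  qed
  have pos: "0 < e" if ev: "eigenvalue ?L e" for e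
  proof -
    obtain w where w: "w \<in> carrier_vec (?n + ?n)" "w \<noteq> 0\<^sub>v (?n + ?n)" "?L *\<^sub>v w = e \<cdot>\<^sub>v w"
      using ev unfolding eigenvalue_def eigenvector_def dim by blast
    define x y where "x = vec_first w ?n" and "y = vec_last w ?n"
    have wxy: "w = x @\<^sub>v y" and xy: "x \<in> carrier_vec ?n" "y \<in> carrier_vec ?n"
      using w(1) by (auto simp: x_def y_def)
    \<comment> \<open>At a node where the eigenvector does not vanish, its pair of entries is an
      eigenvector of the tensor there, for the same \<open>e\<close>.\<close>
    obtain i where i: "i < ?n" "x $ i \<noteq> 0 \<or> y $ i \<noteq> 0"
    proof (rule ccontr)
      assume "\<not> thesis"
      then have "\<forall>i<?n. x $ i = 0 \<and> y $ i = 0" using that by blast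
      then have "w = 0\<^sub>v (?n + ?n)" unfolding wxy using xy by (intro eq_vecI) auto
      then show False using w(2) by simp
    qed
    let ?A = "lam M k i"
    have "(?L *\<^sub>v (x @\<^sub>v y)) $ i = e * x $ i" "(?L *\<^sub>v (x @\<^sub>v y)) $ (?n + i) = e * y $ i"
      using w(3) xy i(1) unfolding wxy by auto
    then have e: "?A $$ (0,0) * x $ i + ?A $$ (0,1) * y $ i = e * x $ i"
        "?A $$ (1,0) * x $ i + ?A $$ (1,1) * y $ i = e * y $ i"
      unfolding Lambda_mult_vec[OF xy] using i(1) by auto
    note A = spd_2x2[of ?A]
    \<comment> \<open>Pairing the eigenvalue equation at node \<open>i\<close> with
      \<open>(x $ i, y $ i)\<close> equates the positive quadratic form with \<open>e\<close> times
      a positive number.\<close>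
    have "?A $$ (0,0) * (x $ i)\<^sup>2 + 2 * ?A $$ (0,1) * x $ i * y $ i + ?A $$ (1,1) * (y $ i)\<^sup>2
      = (?A $$ (0,0) * x $ i + ?A $$ (0,1) * y $ i) * x $ i
        + (?A $$ (1,0) * x $ i + ?A $$ (1,1) * y $ i) * y $ i"
      using A(1) lam[OF i(1)] by (simp add: power2_eq_square algebra_simps)
    also have "\<dots> = e * ((x $ i)\<^sup>2 + (y $ i)\<^sup>2)"
      unfolding e by (simp add: power2_eq_square algebra_simps)
    finally have "0 < e * ((x $ i)\<^sup>2 + (y $ i)\<^sup>2)"
      using A(2)[of "x $ i" "y $ i"] lam[OF i(1)] i(2) by simp
    moreover have "0 < (x $ i)\<^sup>2 + (y $ i)\<^sup>2"
      using i(2) by (simp add: sum_power2_gt_zero_iff)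
    ultimately show ?thesis by (simp add: zero_less_mult_iff)
  qed
  have "{e. eigenvalue ?L e} \<noteq> {}"
  proof -
    \<comment> \<open>An eigenvector of the tensor at node 0, extended by zero to the other nodes,
      is an eigenvector of the whole matrix.\<close>
    let ?A = "lam M k 0"
    obtain e p q where e: "p \<noteq> 0 \<or> q \<noteq> 0" "?A $$ (0,0) * p + ?A $$ (0,1) * q = e * p"
        "?A $$ (0,1) * p + ?A $$ (1,1) * q = e * q"
      using eigenvalue_2x2_ex[of "?A $$ (0,0)" "?A $$ (0,1)" "?A $$ (1,1)"] by blast
    have sym: "?A $$ (1,0) = ?A $$ (0,1)" using spd_2x2(1)[of ?A] lam assms(1) by simp
    let ?v = "\<lambda>p. vec ?n (\<lambda>i. if i = 0 then p else 0)"
    have "?L *\<^sub>v (?v p @\<^sub>v ?v q) = e \<cdot>\<^sub>v (?v p @\<^sub>v ?v q)"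
      by (subst Lambda_mult_vec) (use e sym in \<open>auto intro!: eq_vecI\<close>)
    moreover have "?v p @\<^sub>v ?v q \<noteq> 0\<^sub>v (?n + ?n)"
    proof
      assume "?v p @\<^sub>v ?v q = 0\<^sub>v (?n + ?n)"
      then have "(?v p @\<^sub>v ?v q) $ 0 = 0" "(?v p @\<^sub>v ?v q) $ ?n = 0" using assms(1) by simp_all
      then show False using e(1) assms(1) by simp
    qed
    ultimately have "eigenvector ?L (?v p @\<^sub>v ?v q) e"
      by (auto simp: eigenvector_def dim)
    then show ?thesis by (auto simp: eigenvalue_def)
  qed
  then show ?thesis
    using Max_in[OF fin] pos by (simp add: lambda_max_def)
qed

text \<open>The supremum dominates the members of its set only if the set is bounded above. Unit
  vectors have entries of modulus at most 1, so absolute row sums give a bound; the unit vector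
  selecting column \<open>j\<close> then gives a positive member.\<close>

lemma norm2_pos:
  assumes "i < dim_row A" "j < dim_col A" "A $$ (i,j) \<noteq> 0"
  shows "0 < norm2 A"
proof -
  let ?S = "{v \<in> carrier_vec (dim_col A). v \<bullet> v = 1}"
  let ?f = "\<lambda>v. sqrt ((A *\<^sub>v v) \<bullet> (A *\<^sub>v v))"
  have le1: "\<bar>v $ l\<bar> \<le> 1" if "v \<in> ?S" "l < dim_col A" for v :: "real vec" and l
  proof -
    have "(v $ l)\<^sup>2 \<le> (\<Sum>l\<in>{0..<dim_col A}. (v $ l)\<^sup>2)"
      using that(2) by (intro member_le_sum) auto
    also have "\<dots> = 1" using that(1) by (auto simp: scalar_prod_def power2_eq_square)
    finally show ?thesis by (simp add: abs_square_le_1)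
  qed
  have bdd: "bdd_above (?f ` ?S)"
  proof (rule bdd_aboveI2)
    fix v :: "real vec" assume v: "v \<in> ?S"
    have "\<bar>(A *\<^sub>v v) $ r\<bar> \<le> (\<Sum>l\<in>{0..<dim_col A}. \<bar>A $$ (r,l)\<bar>)" if "r < dim_row A" for r
    proof -
      have "(A *\<^sub>v v) $ r = (\<Sum>l\<in>{0..<dim_col A}. A $$ (r,l) * v $ l)"
        using v that by (auto simp: scalar_prod_def intro!: sum.cong)
      also have "\<bar>\<dots>\<bar> \<le> (\<Sum>l\<in>{0..<dim_col A}. \<bar>A $$ (r,l) * v $ l\<bar>)" by (rule sum_abs)
      also have "\<dots> \<le> (\<Sum>l\<in>{0..<dim_col A}. \<bar>A $$ (r,l)\<bar>)"
        by (intro sum_mono) (use le1[OF v] in \<open>auto simp: abs_mult intro: mult_left_le\<close>)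
      finally show ?thesis .
    qed
    then have "(\<Sum>r\<in>{0..<dim_row A}. ((A *\<^sub>v v) $ r)\<^sup>2)
      \<le> (\<Sum>r\<in>{0..<dim_row A}. (\<Sum>l\<in>{0..<dim_col A}. \<bar>A $$ (r,l)\<bar>)\<^sup>2)"
      by (intro sum_mono abs_le_square_iff[THEN iffD1]) (force simp: sum_nonneg)
    then show "?f v \<le> sqrt (\<Sum>r\<in>{0..<dim_row A}. (\<Sum>l\<in>{0..<dim_col A}. \<bar>A $$ (r,l)\<bar>)\<^sup>2)"
      by (simp add: scalar_prod_def power2_eq_square)
  qed
  let ?e = "unit_vec (dim_col A) j :: real vec"
  have e: "?e \<in> ?S" using assms(2) by simp
  have "0 < (A $$ (i,j))\<^sup>2" using assms(3) by simp
  also have "\<dots> \<le> (\<Sum>r\<in>{0..<dim_row A}. (A $$ (r,j))\<^sup>2)"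
    using assms(1) by (intro member_le_sum[where f = "\<lambda>r. (A $$ (r,j))\<^sup>2"]) auto
  also have "\<dots> = (A *\<^sub>v ?e) \<bullet> (A *\<^sub>v ?e)"
    using assms(2) by (simp add: scalar_prod_def[of "A *\<^sub>v ?e"] power2_eq_square)
  finally have "0 < ?f ?e" by simp
  also have "\<dots> \<le> norm2 A"
    unfolding norm2_def by (rule cSUP_upper[OF e bdd])
  finally show ?thesis .
qed

section \<open>Reduction of equal SATs to equal coefficients\<close>

lemma vec_sum_cong:
  assumes "S = T" "\<And>s. s \<in> T \<Longrightarrow> f s = g s"
  shows "vec_sum n f S = vec_sum n g T"
  unfolding vec_sum_def using assms by (auto intro!: eq_vecI sum.cong)

text \<open>The terms are sums built from the coefficients. In element \<open>k\<close> the SAT uses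
  \<open>T6\<close> at the neighbour \<open>v\<close>, so the agreement of extended coefficients is
  needed at \<open>v\<close> as well; the last hypothesis transfers it there.\<close>

lemma same_SAT_if_coefficients_eq:
  assumes int: "\<And>k \<gamma>. k \<in> elems M \<Longrightarrow> \<gamma> \<in> int_facets M k \<Longrightarrow>
      T1 C \<gamma> k = T1 C' \<gamma> k \<and> T2 C \<gamma> k = T2 C' \<gamma> k \<and> T3 C \<gamma> k = T3 C' \<gamma> k \<and> T4 C \<gamma> k = T4 C' \<gamma> k"
    and ext: "\<And>k \<gamma> \<epsilon>. k \<in> elems M \<Longrightarrow> \<gamma> \<in> int_facets M k \<Longrightarrow> \<epsilon> \<in> int_facets M k \<Longrightarrow> \<gamma> \<noteq> \<epsilon> \<Longrightarrow>
      T5 C \<gamma> \<epsilon> k = T5 C' \<gamma> \<epsilon> k \<and> T6 C \<gamma> \<epsilon> k = T6 C' \<gamma> \<epsilon> k"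
    and dir: "\<And>k \<gamma>. k \<in> elems M \<Longrightarrow> \<gamma> \<in> dir_facets M k \<Longrightarrow> TD C \<gamma> k = TD C' \<gamma> k"
    and nbr: "\<And>k \<gamma>. k \<in> elems M \<Longrightarrow> \<gamma> \<in> int_facets M k \<Longrightarrow>
      nbr M \<gamma> k \<in> elems M \<and> \<gamma> \<in> int_facets M (nbr M \<gamma> k)"
  shows "same_SAT M C C'"
proof -
  have "SAT M C u g k = SAT M C' u g k" if k: "k \<in> elems M" for u g k
    unfolding SAT_def interface_SAT_def dirichlet_SAT_def Let_def
    using k int ext dir nbr
    by (intro arg_cong2[where f = "(+)"] vec_sum_cong refl) auto
  then show ?thesis
    unfolding same_SAT_def using int ext dir by blast
qed

text \<open>The SIPG Dirichlet coefficient divided node by node by the BR1 one. Summing over the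
  adjacent elements makes the same formula, halved, the quotient of the interface coefficients.
  The value 1 at facets of no element only serves to keep the factor positive.\<close>

definition node_ratio :: "('e, 'f) disc \<Rightarrow> 'f \<Rightarrow> real mat" where
  "node_ratio M \<gamma> = mat_diag (nf M) (\<lambda>i. if adj M \<gamma> = {} then 1 else
     (\<Sum>k\<in>adj M \<gamma>. lambda_max (Lambda M k) * trace_const M \<gamma> k / alpha M \<gamma> k) /
     (B M \<gamma> $$ (i,i) * (\<Sum>k\<in>adj M \<gamma>. Upsilon M \<gamma> \<gamma> k $$ (i,i) / alpha M \<gamma> k)))"

section \<open>\<Upsilon> and the trace constant for \<open>R\<^sup>0\<close> operators\<close>

context
  fixes M :: "('e, 'f) disc"
  assumes sbp: "sbp_discretization M" and R0: "R0_family M"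
begin

text \<open>Exactly two elements meet at an interior facet, so the definite description in
  \<open>nbr\<close> has a unique candidate.\<close>

lemma int_facet_nbr:
  assumes "k \<in> elems M" "\<gamma> \<in> int_facets M k"
  shows "adj M \<gamma> = {k, nbr M \<gamma> k}" "nbr M \<gamma> k \<noteq> k" "nbr M \<gamma> k \<in> elems M"
    "\<gamma> \<in> int_facets M (nbr M \<gamma> k)"
proof -
  have k: "k \<in> adj M \<gamma>" and card: "card (adj M \<gamma>) = 2"
    using assms by (auto simp: adj_def int_facets_def)
  then obtain v where v: "adj M \<gamma> = {k, v}" "v \<noteq> k"
    by (auto simp: card_2_iff doubleton_eq_iff)
  then have "nbr M \<gamma> k = v" unfolding nbr_def by (intro the_equality) auto
  with v show *: "adj M \<gamma> = {k, nbr M \<gamma> k}" "nbr M \<gamma> k \<noteq> k" by auto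
  then have "nbr M \<gamma> k \<in> adj M \<gamma>" by simp
  then show "nbr M \<gamma> k \<in> elems M" "\<gamma> \<in> int_facets M (nbr M \<gamma> k)"
    using card by (auto simp: adj_def int_facets_def)
qed

lemma facet_matrices:
  assumes "k \<in> elems M" "\<gamma> \<in> facets M k"
  shows "pos_diag (nf M) (B M \<gamma>)" "R M \<gamma> k \<in> carrier_mat (nf M) (np M)"
    "Nx M \<gamma> k \<in> carrier_mat (nf M) (nf M)" "diagonal_mat (Nx M \<gamma> k)"
    "Ny M \<gamma> k \<in> carrier_mat (nf M) (nf M)" "diagonal_mat (Ny M \<gamma> k)"
    "i < nf M \<Longrightarrow> (Nx M \<gamma> k $$ (i,i))\<^sup>2 + (Ny M \<gamma> k $$ (i,i))\<^sup>2 = 1"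
    "0 < alpha M \<gamma> k"
  using sbp assms unfolding sbp_discretization_def by blast+

lemma elem_matrices:
  assumes "k \<in> elems M"
  shows "H M k \<in> carrier_mat (np M) (np M)" "spd (H M k)"
    "i < np M \<Longrightarrow> lam M k i \<in> carrier_mat 2 2" "i < np M \<Longrightarrow> spd (lam M k i)"
  using sbp assms unfolding sbp_discretization_def by blast+

lemma R_R0:
  assumes "k \<in> elems M" "n \<in> {1,2,3}"
  shows "R M (facet M k n) k = mat (nf M) (np M) (\<lambda>(i,j). if i + (n - 1) * nf M = j then 1 else 0)"
  using R0 assms unfolding R0_family_def by blast

text \<open>Positive definiteness is tested on the \<open>i\<close>-th unit vector.\<close>

lemma H_diag_pos:
  assumes "k \<in> elems M" "i < np M"
  shows "0 < H M k $$ (i,i)"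
proof -
  note H = elem_matrices(1,2)[OF assms(1)]
  let ?e = "unit_vec (np M) i :: real vec"
  have "?e \<noteq> 0\<^sub>v (np M)" using assms(2) by simp
  then have "0 < ?e \<bullet> (H M k *\<^sub>v ?e)" using H unfolding spd_def by auto
  also have "?e \<bullet> (H M k *\<^sub>v ?e) = H M k $$ (i,i)"
    using assms(2) H(1) by simp
  finally show ?thesis .
qed

text \<open>Each of the four terms of \<open>Upsilon_eq\<close> is a \<open>place_sandwich\<close>,
  with offset \<open>(n - 1) * nf M\<close> on the left and \<open>(m - 1) * nf M\<close> on the
  right. An entry survives only when both facet nodes are the same volume node \<open>j\<close>; it
  is then the two normals paired through the tensor at \<open>j\<close>, divided by the norm
  entry.\<close>

lemma Upsilon_R0:
  assumes k: "k \<in> elems M" and n: "n \<in> {1,2,3}" and m: "m \<in> {1,2,3}"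
  defines "a \<equiv> facet M k n" and "b \<equiv> facet M k m"
  shows "Upsilon M a b k = mat (nf M) (nf M) (\<lambda>(i,l). if i + (n - 1) * nf M = l + (m - 1) * nf M
    then let j = i + (n - 1) * nf M; L = lam M k j in
      inverse (H M k $$ (j,j)) *
       (Nx M a k $$ (i,i) * L $$ (0,0) * Nx M b k $$ (l,l)
        + Ny M a k $$ (i,i) * L $$ (1,0) * Nx M b k $$ (l,l)
        + Nx M a k $$ (i,i) * L $$ (0,1) * Ny M b k $$ (l,l)
        + Ny M a k $$ (i,i) * L $$ (1,1) * Ny M b k $$ (l,l))
    else 0)"
proof -
  \<comment> \<open>The three blocks of \<open>nf M\<close> nodes fit into the volume nodes because
    \<open>3 * nf M \<le> np M\<close>.\<close>
  have le: "nf M + (p - 1) * nf M \<le> np M" if "p \<in> {1,2,3}" for p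
    using that R0 by (auto simp: R0_family_def)
  have ab: "a \<in> facets M k" "b \<in> facets M k" using n m by (auto simp: a_def b_def facets_def)
  note fa = facet_matrices[OF k ab(1)] and fb = facet_matrices[OF k ab(2)]
  note P = place_selection[OF fa(3,4)] place_selection[OF fa(5,6)]
    place_selection[OF fb(3,4)] place_selection[OF fb(5,6)]
  show ?thesis
    unfolding Upsilon_eq[OF elem_matrices(1)[OF k] fa(2) fb(2) fa(3,5) fb(3,5)]
    unfolding R_R0[OF k n, folded a_def] R_R0[OF k m, folded b_def] P
      place_sandwich[OF le[OF n] le[OF n]] place_sandwich[OF le[OF n] le[OF m]]
    by (rule eq_matI) (auto simp: Let_def algebra_simps)
qed

lemma Upsilon_distinct_facets:
  assumes k: "k \<in> elems M" and ab: "a \<in> facets M k" "b \<in> facets M k" "a \<noteq> b"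
  shows "Upsilon M a b k = 0\<^sub>m (nf M) (nf M)"
proof -
  obtain n m where n: "n \<in> {1,2,3}" "a = facet M k n" and m: "m \<in> {1,2,3}" "b = facet M k m"
    using ab unfolding facets_def by blast
  \<comment> \<open>Different facets have different numbers, and their blocks of \<open>nf M\<close>
    consecutive volume nodes are disjoint.\<close>
  have "i + (n - 1) * nf M \<noteq> l + (m - 1) * nf M" if "i < nf M" "l < nf M" for i l
    using n m ab(3) that by auto
  then show ?thesis
    unfolding n(2) m(2) Upsilon_R0[OF k n(1) m(1)] by (intro eq_matI) auto
qed

text \<open>With equal offsets two facet nodes coincide only if \<open>i = l\<close>, so the matrix
  is diagonal. Its entries are the quadratic form of the tensor at a unit, hence nonzero, normal,
  divided by a positive norm entry.\<close>

lemma Upsilon_same_facet: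
  assumes k: "k \<in> elems M" and a: "a \<in> facets M k"
  shows "Upsilon M a a k = mat_diag (nf M) (\<lambda>i. Upsilon M a a k $$ (i,i))"
    and "i < nf M \<Longrightarrow> 0 < Upsilon M a a k $$ (i,i)"
proof -
  obtain n where n: "n \<in> {1,2,3}" "a = facet M k n" using a unfolding facets_def by blast
  note U = Upsilon_R0[OF k n(1) n(1), folded n(2)]
  show "Upsilon M a a k = mat_diag (nf M) (\<lambda>i. Upsilon M a a k $$ (i,i))"
    by (rule diagonal_mat_eq_mat_diag) (auto simp: U diagonal_mat_def)
  assume i: "i < nf M"
  define j where "j = i + (n - 1) * nf M"
  have j: "j < np M" using n(1) i R0 by (auto simp: R0_family_def j_def)
  let ?x = "Nx M a k $$ (i,i)" and ?y = "Ny M a k $$ (i,i)" and ?L = "lam M k j"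
  have "?x \<noteq> 0 \<or> ?y \<noteq> 0" using facet_matrices(7)[OF k a i] by auto
  then have pos: "0 < ?L $$ (0,0) * ?x\<^sup>2 + 2 * ?L $$ (0,1) * ?x * ?y + ?L $$ (1,1) * ?y\<^sup>2"
    using spd_2x2(2) elem_matrices(3,4)[OF k j] by blast
  have "Upsilon M a a k $$ (i,i) = inverse (H M k $$ (j,j)) *
      (?L $$ (0,0) * ?x\<^sup>2 + 2 * ?L $$ (0,1) * ?x * ?y + ?L $$ (1,1) * ?y\<^sup>2)"
    using i spd_2x2(1)[OF elem_matrices(4)[OF k j] elem_matrices(3)[OF k j]]
    by (simp add: U j_def[unfolded One_nat_def, symmetric] Let_def)
      (simp add: power2_eq_square algebra_simps)
  then show "0 < Upsilon M a a k $$ (i,i)"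
    using pos H_diag_pos[OF k j] by simp
qed

text \<open>Node 0 of facet \<open>n\<close> is volume node \<open>(n - 1) * nf M\<close>. There the
  weighted extrapolation matrix has a positive entry, so its norm is positive.\<close>

lemma trace_const_pos:
  assumes k: "k \<in> elems M" and a: "a \<in> facets M k"
  shows "0 < trace_const M a k"
proof -
  obtain n where n: "n \<in> {1,2,3}" "a = facet M k n" using a unfolding facets_def by blast
  define j where "j = (n - 1) * nf M"
  have nf: "0 < nf M" using sbp by (simp add: sbp_discretization_def)
  have j: "j < np M" using n(1) nf R0 by (auto simp: R0_family_def j_def)
  have R: "R M a k $$ (0,j) = 1" using nf j by (simp add: R_R0[OF k n(1)] n(2) j_def)
  note fa = facet_matrices[OF k a]
  have B: "0 < B M a $$ (0,0)" "B M a \<in> carrier_mat (nf M) (nf M)"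
    using fa(1) nf by (auto simp: pos_diag_def)
  let ?A = "diag_fun sqrt (B M a) * R M a k * diag_fun (\<lambda>x. inverse (sqrt x)) (H M k)"
  have A: "?A = mat (nf M) (np M) (\<lambda>(i,j). sqrt (B M a $$ (i,i)) * R M a k $$ (i,j)
      * inverse (sqrt (H M k $$ (j,j))))"
    unfolding diag_fun_def using B(2) fa(2) elem_matrices(1)[OF k]
    by (simp add: mat_diag_mult_left mat_diag_mult_right[of _ "nf M"]) (auto intro!: eq_matI)
  have "?A $$ (0,j) \<noteq> 0"
    unfolding A using nf j R B(1) H_diag_pos[OF k j] by simp
  then have "0 < norm2 ?A"
    using nf j by (intro norm2_pos[of 0 _ j]) (auto simp: A)
  then show ?thesis by (simp add: trace_const_def)
qed

section \<open>The node-by-node quotient of the SIPG and BR1 coefficients\<close>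

lemma finite_adj: "finite (adj M \<gamma>)"
  using sbp by (simp add: sbp_discretization_def adj_def)

lemma B_pos_diag:
  assumes "k \<in> adj M \<gamma>"
  shows "B M \<gamma> = mat_diag (nf M) (\<lambda>i. B M \<gamma> $$ (i,i))" "i < nf M \<Longrightarrow> 0 < B M \<gamma> $$ (i,i)"
proof -
  have "pos_diag (nf M) (B M \<gamma>)" using facet_matrices(1) assms by (auto simp: adj_def)
  then show "B M \<gamma> = mat_diag (nf M) (\<lambda>i. B M \<gamma> $$ (i,i))" "i < nf M \<Longrightarrow> 0 < B M \<gamma> $$ (i,i)"
    by (auto simp: pos_diag_def intro: diagonal_mat_eq_mat_diag)
qed

text \<open>These sums make up the numerator and denominator of \<open>node_ratio\<close>; every
  summand is positive.\<close>

lemma adj_sums_pos: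
  assumes "adj M \<gamma> \<noteq> {}"
  shows "0 < (\<Sum>k\<in>adj M \<gamma>. lambda_max (Lambda M k) * trace_const M \<gamma> k / alpha M \<gamma> k)"
    and "i < nf M \<Longrightarrow> 0 < (\<Sum>k\<in>adj M \<gamma>. Upsilon M \<gamma> \<gamma> k $$ (i,i) / alpha M \<gamma> k)"
proof -
  have np: "0 < np M" using sbp by (simp add: sbp_discretization_def)
  show "0 < (\<Sum>k\<in>adj M \<gamma>. lambda_max (Lambda M k) * trace_const M \<gamma> k / alpha M \<gamma> k)"
    using lambda_max_Lambda_pos[OF np] elem_matrices(3,4) trace_const_pos facet_matrices(8) assms
    by (intro sum_pos[OF finite_adj]) (auto simp: adj_def)
  show "i < nf M \<Longrightarrow> 0 < (\<Sum>k\<in>adj M \<gamma>. Upsilon M \<gamma> \<gamma> k $$ (i,i) / alpha M \<gamma> k)"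
    using Upsilon_same_facet(2) facet_matrices(8) assms
    by (intro sum_pos[OF finite_adj]) (auto simp: adj_def)
qed

lemma node_ratio_pos_diag: "pos_diag (nf M) (node_ratio M \<gamma>)"
proof -
  have "0 < node_ratio M \<gamma> $$ (i,i)" if "i < nf M" for i
    using that adj_sums_pos[of \<gamma>] B_pos_diag(2)[of _ \<gamma> i]
    by (cases "adj M \<gamma> = {}") (auto simp: node_ratio_def mat_diag_def)
  then show ?thesis by (auto simp: pos_diag_def node_ratio_def diagonal_mat_def mat_diag_def)
qed

text \<open>All matrices are diagonal, and at each node \<open>c / (b * u)\<close> times
  \<open>b * u * b\<close> leaves \<open>c * b\<close>. Stating this for sums over adjacent elements
  covers interior facets, with two summands, and Dirichlet facets, with one.\<close>

lemma node_ratio_mult: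
  assumes "adj M \<gamma> \<noteq> {}"
    and U: "U = mat_diag (nf M) (\<lambda>i. \<Sum>k\<in>adj M \<gamma>. Upsilon M \<gamma> \<gamma> k $$ (i,i) / alpha M \<gamma> k)"
  shows "node_ratio M \<gamma> * (B M \<gamma> * U * B M \<gamma>)
    = (\<Sum>k\<in>adj M \<gamma>. lambda_max (Lambda M k) * trace_const M \<gamma> k / alpha M \<gamma> k) \<cdot>\<^sub>m B M \<gamma>"
proof -
  obtain k where k: "k \<in> adj M \<gamma>" using assms by blast
  have B: "B M \<gamma> = mat_diag (nf M) (\<lambda>i. B M \<gamma> $$ (i,i))" by (rule B_pos_diag(1)[OF k])
  have nz: "B M \<gamma> $$ (i,i) \<noteq> 0" "(\<Sum>k\<in>adj M \<gamma>. Upsilon M \<gamma> \<gamma> k $$ (i,i) / alpha M \<gamma> k) \<noteq> 0"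
    if "i < nf M" for i
    using B_pos_diag(2)[OF k that] adj_sums_pos(2)[OF assms(1) that] by linarith+
  define b u where "b = (\<lambda>i. B M \<gamma> $$ (i,i))"
    and "u = (\<lambda>i. \<Sum>k\<in>adj M \<gamma>. Upsilon M \<gamma> \<gamma> k $$ (i,i) / alpha M \<gamma> k)"
  define c where "c = (\<Sum>k\<in>adj M \<gamma>. lambda_max (Lambda M k) * trace_const M \<gamma> k / alpha M \<gamma> k)"
  have bu: "b i \<noteq> 0" "u i \<noteq> 0" if "i < nf M" for i
    using nz[OF that] by (simp_all add: b_def u_def)
  have "node_ratio M \<gamma> = mat_diag (nf M) (\<lambda>i. c / (b i * u i))"
    using assms(1) by (simp add: node_ratio_def b_def u_def c_def)
  moreover have "mat_diag (nf M) (\<lambda>i. c / (b i * u i)) * (mat_diag (nf M) b * mat_diag (nf M) u * mat_diag (nf M) b)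
    = c \<cdot>\<^sub>m mat_diag (nf M) b"
    unfolding mat_diag_diag using bu by (auto simp: mat_diag_def intro!: eq_matI)
  ultimately show ?thesis
    unfolding U b_def u_def c_def B[symmetric] by simp
qed

text \<open>Only the denominator of the ratio depends on the node. If
  \<open>B M \<gamma> * Upsilon M \<gamma> \<gamma> k\<close> is \<open>c k\<close> times the
  identity, the denominator is the sum of \<open>c k / alpha M \<gamma> k\<close> at every
  node.\<close>

lemma node_ratio_scalar:
  assumes "\<forall>k \<in> adj M \<gamma>. \<exists>c. B M \<gamma> * Upsilon M \<gamma> \<gamma> k = c \<cdot>\<^sub>m 1\<^sub>m (nf M)"
  shows "\<exists>s. node_ratio M \<gamma> = s \<cdot>\<^sub>m 1\<^sub>m (nf M)"
proof (cases "adj M \<gamma> = {}")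
  case True
  then have "node_ratio M \<gamma> = 1 \<cdot>\<^sub>m 1\<^sub>m (nf M)"
    by (auto simp: node_ratio_def mat_diag_def intro!: eq_matI)
  then show ?thesis by blast
next
  case False
  obtain c where c: "\<And>k. k \<in> adj M \<gamma> \<Longrightarrow> B M \<gamma> * Upsilon M \<gamma> \<gamma> k = c k \<cdot>\<^sub>m 1\<^sub>m (nf M)"
    using bchoice[OF assms] by blast
  have node: "B M \<gamma> $$ (i,i) * Upsilon M \<gamma> \<gamma> k $$ (i,i) = c k" if "k \<in> adj M \<gamma>" "i < nf M" for k i
  proof -
    have kf: "k \<in> elems M" "\<gamma> \<in> facets M k" using that(1) by (auto simp: adj_def)
    have "B M \<gamma> * Upsilon M \<gamma> \<gamma> k
      = mat_diag (nf M) (\<lambda>i. B M \<gamma> $$ (i,i) * Upsilon M \<gamma> \<gamma> k $$ (i,i))"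
      using B_pos_diag(1)[OF that(1)] Upsilon_same_facet(1)[OF kf] mat_diag_diag by metis
    then have "(B M \<gamma> * Upsilon M \<gamma> \<gamma> k) $$ (i,i) = B M \<gamma> $$ (i,i) * Upsilon M \<gamma> \<gamma> k $$ (i,i)"
      using that(2) by (simp add: mat_diag_def)
    then show ?thesis using c[OF that(1)] that(2) by simp
  qed
  let ?s = "(\<Sum>k\<in>adj M \<gamma>. lambda_max (Lambda M k) * trace_const M \<gamma> k / alpha M \<gamma> k)"
  have "B M \<gamma> $$ (i,i) * (\<Sum>k\<in>adj M \<gamma>. Upsilon M \<gamma> \<gamma> k $$ (i,i) / alpha M \<gamma> k)
    = (\<Sum>k\<in>adj M \<gamma>. c k / alpha M \<gamma> k)" if "i < nf M" for i
    unfolding sum_distrib_left using node[OF _ that] by (intro sum.cong) auto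
  then have "node_ratio M \<gamma> = (?s / (\<Sum>k\<in>adj M \<gamma>. c k / alpha M \<gamma> k)) \<cdot>\<^sub>m 1\<^sub>m (nf M)"
    using False by (auto simp: node_ratio_def mat_diag_def intro!: eq_matI)
  then show ?thesis by blast
qed

section \<open>Equivalence of the SATs\<close>

lemma Upsilon_carrier:
  assumes "k \<in> adj M \<gamma>"
  shows "Upsilon M \<gamma> \<gamma> k \<in> carrier_mat (nf M) (nf M)"
  by (subst Upsilon_same_facet(1)) (use assms in \<open>auto simp: adj_def\<close>)

lemma B_carrier:
  assumes "k \<in> adj M \<gamma>"
  shows "B M \<gamma> \<in> carrier_mat (nf M) (nf M)"
  by (subst B_pos_diag(1)[OF assms]) simp

lemma adj_int_facet:
  assumes "k \<in> elems M" "\<gamma> \<in> int_facets M k"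
  shows "k \<in> adj M \<gamma>" "nbr M \<gamma> k \<in> adj M \<gamma>"
  using int_facet_nbr(1)[OF assms] by auto

text \<open>Reduces the sums in \<open>node_ratio\<close> to one summand on Dirichlet
  facets.\<close>

lemma adj_dir_facet:
  assumes "k \<in> elems M" "\<gamma> \<in> dir_facets M k"
  shows "adj M \<gamma> = {k}"
proof -
  have "k \<in> adj M \<gamma>" "card (adj M \<gamma>) = 1"
    using assms sbp by (auto simp: adj_def dir_facets_def sbp_discretization_def)
  then show ?thesis by (auto simp: card_1_singleton_iff)
qed

lemma smult_smult_mat: "a \<cdot>\<^sub>m (b \<cdot>\<^sub>m A) = (a * b :: real) \<cdot>\<^sub>m A"
  by (rule eq_matI) auto

lemma smult_one_mult:
  fixes A :: "real mat"
  assumes "dim_row A = n"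
  shows "s \<cdot>\<^sub>m 1\<^sub>m n * A = s \<cdot>\<^sub>m A"
  using assms by (subst mult_smult_assoc_mat[of _ n n _ "dim_col A"]) auto

text \<open>The common form of \<open>T5\<close> and \<open>T6\<close> in BR1 and LDG; the scalar
  \<open>s\<close> stands for the factors 1/16 and -1/16 and for the products of switches.\<close>

lemma extended_terms_zero:
  assumes "k \<in> elems M" "\<gamma> \<in> int_facets M k" "\<epsilon> \<in> int_facets M k" "\<gamma> \<noteq> \<epsilon>"
  shows "s \<cdot>\<^sub>m (B M \<gamma> * Upsilon M \<gamma> \<epsilon> k * B M \<epsilon>) = 0\<^sub>m (nf M) (nf M)"
proof -
  have "Upsilon M \<gamma> \<epsilon> k = 0\<^sub>m (nf M) (nf M)"
    using assms by (intro Upsilon_distinct_facets) (auto simp: int_facets_def)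
  then show ?thesis
    using B_carrier[OF adj_int_facet(1)[OF assms(1,2)]] B_carrier[OF adj_int_facet(1)[OF assms(1,3)]]
    by (auto intro!: eq_matI)
qed

text \<open>Halving turns the prefactor 1/2 of \<open>T1\<close> into 1/4. \<open>TD\<close> is
  shared, hence the factor 1, and the extended terms of BR1 vanish.\<close>

lemma same_SAT_BR1_BR2:
  "same_SAT M (scale_SAT (\<lambda>_. (1/2) \<cdot>\<^sub>m 1\<^sub>m (nf M)) (\<lambda>_. 1 \<cdot>\<^sub>m 1\<^sub>m (nf M)) (BR1 M)) (BR2 M)"
proof (rule same_SAT_if_coefficients_eq)
  fix k \<gamma> assume a: "k \<in> elems M" "\<gamma> \<in> int_facets M k"
  note c = B_carrier[OF adj_int_facet(1)[OF a], THEN carrier_matD(1)]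
  show "nbr M \<gamma> k \<in> elems M \<and> \<gamma> \<in> int_facets M (nbr M \<gamma> k)"
    using int_facet_nbr[OF a] by simp
  show "T1 (scale_SAT (\<lambda>_. (1/2) \<cdot>\<^sub>m 1\<^sub>m (nf M)) (\<lambda>_. 1 \<cdot>\<^sub>m 1\<^sub>m (nf M)) (BR1 M)) \<gamma> k = T1 (BR2 M) \<gamma> k \<and>
      T2 (scale_SAT (\<lambda>_. (1/2) \<cdot>\<^sub>m 1\<^sub>m (nf M)) (\<lambda>_. 1 \<cdot>\<^sub>m 1\<^sub>m (nf M)) (BR1 M)) \<gamma> k = T2 (BR2 M) \<gamma> k \<and>
      T3 (scale_SAT (\<lambda>_. (1/2) \<cdot>\<^sub>m 1\<^sub>m (nf M)) (\<lambda>_. 1 \<cdot>\<^sub>m 1\<^sub>m (nf M)) (BR1 M)) \<gamma> k = T3 (BR2 M) \<gamma> k \<and>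
      T4 (scale_SAT (\<lambda>_. (1/2) \<cdot>\<^sub>m 1\<^sub>m (nf M)) (\<lambda>_. 1 \<cdot>\<^sub>m 1\<^sub>m (nf M)) (BR1 M)) \<gamma> k = T4 (BR2 M) \<gamma> k"
    using c by (simp add: scale_SAT_def BR1_def BR2_def Let_def smult_one_mult smult_smult_mat)
next
  fix k \<gamma> assume a: "k \<in> elems M" "\<gamma> \<in> dir_facets M k"
  then have k: "k \<in> adj M \<gamma>" by (simp add: adj_dir_facet)
  show "TD (scale_SAT (\<lambda>_. (1/2) \<cdot>\<^sub>m 1\<^sub>m (nf M)) (\<lambda>_. 1 \<cdot>\<^sub>m 1\<^sub>m (nf M)) (BR1 M)) \<gamma> k = TD (BR2 M) \<gamma> k"
    using B_carrier[OF k, THEN carrier_matD(1)]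
    by (simp add: scale_SAT_def BR1_def BR2_def smult_one_mult smult_smult_mat)
qed (simp add: scale_SAT_def BR1_def BR2_def extended_terms_zero)

text \<open>CDG halves \<open>T1\<close> of LDG and keeps \<open>TD\<close>; the extended terms it
  drops are zero.\<close>

lemma same_SAT_LDG_CDG:
  "same_SAT M (scale_SAT (\<lambda>_. (1/2) \<cdot>\<^sub>m 1\<^sub>m (nf M)) (\<lambda>_. 1 \<cdot>\<^sub>m 1\<^sub>m (nf M)) (LDG M \<beta>)) (CDG M \<beta>)"
proof (rule same_SAT_if_coefficients_eq)
  fix k \<gamma> assume a: "k \<in> elems M" "\<gamma> \<in> int_facets M k"
  note c = B_carrier[OF adj_int_facet(1)[OF a], THEN carrier_matD(1)]
  show "nbr M \<gamma> k \<in> elems M \<and> \<gamma> \<in> int_facets M (nbr M \<gamma> k)"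
    using int_facet_nbr[OF a] by simp
  show "T1 (scale_SAT (\<lambda>_. (1/2) \<cdot>\<^sub>m 1\<^sub>m (nf M)) (\<lambda>_. 1 \<cdot>\<^sub>m 1\<^sub>m (nf M)) (LDG M \<beta>)) \<gamma> k = T1 (CDG M \<beta>) \<gamma> k \<and>
      T2 (scale_SAT (\<lambda>_. (1/2) \<cdot>\<^sub>m 1\<^sub>m (nf M)) (\<lambda>_. 1 \<cdot>\<^sub>m 1\<^sub>m (nf M)) (LDG M \<beta>)) \<gamma> k = T2 (CDG M \<beta>) \<gamma> k \<and>
      T3 (scale_SAT (\<lambda>_. (1/2) \<cdot>\<^sub>m 1\<^sub>m (nf M)) (\<lambda>_. 1 \<cdot>\<^sub>m 1\<^sub>m (nf M)) (LDG M \<beta>)) \<gamma> k = T3 (CDG M \<beta>) \<gamma> k \<and>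
      T4 (scale_SAT (\<lambda>_. (1/2) \<cdot>\<^sub>m 1\<^sub>m (nf M)) (\<lambda>_. 1 \<cdot>\<^sub>m 1\<^sub>m (nf M)) (LDG M \<beta>)) \<gamma> k = T4 (CDG M \<beta>) \<gamma> k"
    using c by (simp add: scale_SAT_def LDG_def CDG_def Let_def smult_one_mult smult_smult_mat)
next
  fix k \<gamma> assume a: "k \<in> elems M" "\<gamma> \<in> dir_facets M k"
  then have k: "k \<in> adj M \<gamma>" by (simp add: adj_dir_facet)
  show "TD (scale_SAT (\<lambda>_. (1/2) \<cdot>\<^sub>m 1\<^sub>m (nf M)) (\<lambda>_. 1 \<cdot>\<^sub>m 1\<^sub>m (nf M)) (LDG M \<beta>)) \<gamma> k = TD (CDG M \<beta>) \<gamma> k"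
    using B_carrier[OF k, THEN carrier_matD(1)]
    by (simp add: scale_SAT_def LDG_def CDG_def smult_one_mult smult_smult_mat)
qed (simp add: scale_SAT_def LDG_def CDG_def Let_def extended_terms_zero)

text \<open>On Dirichlet facets the ratio itself converts \<open>TD\<close>. On interior facets it
  is halved, since BR1 has the prefactor 1/2 and SIPG has 1/4.\<close>

lemma same_SAT_BR1_SIPG:
  "same_SAT M (scale_SAT (\<lambda>\<gamma>. (1/2) \<cdot>\<^sub>m node_ratio M \<gamma>) (node_ratio M) (BR1 M)) (SIPG M)"
proof (rule same_SAT_if_coefficients_eq)
  let ?C = "scale_SAT (\<lambda>\<gamma>. (1/2) \<cdot>\<^sub>m node_ratio M \<gamma>) (node_ratio M) (BR1 M)"
  fix k \<gamma> assume a: "k \<in> elems M" "\<gamma> \<in> int_facets M k"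
  let ?v = "nbr M \<gamma> k"
  note kv = adj_int_facet[OF a] and nb = int_facet_nbr[OF a]
  note Bc = B_carrier[OF kv(1)] and Uc = kv[THEN Upsilon_carrier]
  have rc: "node_ratio M \<gamma> \<in> carrier_mat (nf M) (nf M)" by (simp add: node_ratio_def)
  have sum: "(\<Sum>j\<in>adj M \<gamma>. f j) = f k + f ?v" for f :: "'e \<Rightarrow> real"
    using nb(2) unfolding nb(1) by simp
  let ?U = "(1 / alpha M \<gamma> k) \<cdot>\<^sub>m Upsilon M \<gamma> \<gamma> k + (1 / alpha M \<gamma> ?v) \<cdot>\<^sub>m Upsilon M \<gamma> \<gamma> ?v"
  let ?u = "\<lambda>i. Upsilon M \<gamma> \<gamma> k $$ (i,i) / alpha M \<gamma> k + Upsilon M \<gamma> \<gamma> ?v $$ (i,i) / alpha M \<gamma> ?v"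
  have d: "Upsilon M \<gamma> \<gamma> j = mat_diag (nf M) (\<lambda>i. Upsilon M \<gamma> \<gamma> j $$ (i,i))" if "j \<in> adj M \<gamma>" for j
    using Upsilon_same_facet(1)[of j \<gamma>] that by (simp add: adj_def)
  \<comment> \<open>Vanishing off-diagonal entries put the bracket of \<open>T1\<close> into the
    summed diagonal form required by \<open>node_ratio_mult\<close>.\<close>
  have "Upsilon M \<gamma> \<gamma> j $$ (i,l) = 0" if "j \<in> adj M \<gamma>" "i < nf M" "l < nf M" "i \<noteq> l" for j i l
    by (subst d[OF that(1)]) (use that in \<open>simp add: mat_diag_def\<close>)
  then have "?U = mat_diag (nf M) (\<lambda>i. \<Sum>j\<in>adj M \<gamma>. Upsilon M \<gamma> \<gamma> j $$ (i,i) / alpha M \<gamma> j)"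
    unfolding sum using Uc kv by (intro eq_matI) (auto simp: mat_diag_def)
  then have "node_ratio M \<gamma> * (B M \<gamma> * ?U * B M \<gamma>)
    = (lambda_max (Lambda M k) * trace_const M \<gamma> k / alpha M \<gamma> k
       + lambda_max (Lambda M ?v) * trace_const M \<gamma> ?v / alpha M \<gamma> ?v) \<cdot>\<^sub>m B M \<gamma>"
    using node_ratio_mult[of \<gamma> ?U] kv unfolding sum by blast
  \<comment> \<open>One half comes from the scaling factor and one from BR1; together they give the
    1/4 of SIPG.\<close>
  moreover have "(1/2) \<cdot>\<^sub>m node_ratio M \<gamma> * ((1/2) \<cdot>\<^sub>m (B M \<gamma> * ?U * B M \<gamma>))
    = (1/4) \<cdot>\<^sub>m (node_ratio M \<gamma> * (B M \<gamma> * ?U * B M \<gamma>))"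
  proof -
    have "B M \<gamma> * ?U * B M \<gamma> \<in> carrier_mat (nf M) (nf M)" using Bc Uc by auto
    then show ?thesis
      using rc by (simp add: mult_smult_assoc_mat[of _ "nf M" "nf M"] mult_smult_distrib[of _ "nf M" "nf M"]
          smult_smult_mat)
  qed
  ultimately have "(1/2) \<cdot>\<^sub>m node_ratio M \<gamma> * ((1/2) \<cdot>\<^sub>m (B M \<gamma> * ?U * B M \<gamma>))
    = (lambda_max (Lambda M k) * trace_const M \<gamma> k / (4 * alpha M \<gamma> k)
       + lambda_max (Lambda M ?v) * trace_const M \<gamma> ?v / (4 * alpha M \<gamma> ?v)) \<cdot>\<^sub>m B M \<gamma>"
    by (simp add: smult_smult_mat distrib_left)
  then show "T1 ?C \<gamma> k = T1 (SIPG M) \<gamma> k \<and> T2 ?C \<gamma> k = T2 (SIPG M) \<gamma> k \<and>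
      T3 ?C \<gamma> k = T3 (SIPG M) \<gamma> k \<and> T4 ?C \<gamma> k = T4 (SIPG M) \<gamma> k"
    by (simp add: scale_SAT_def BR1_def BR2_def SIPG_def Let_def)
  show "nbr M \<gamma> k \<in> elems M \<and> \<gamma> \<in> int_facets M (nbr M \<gamma> k)" using nb by simp
next
  let ?C = "scale_SAT (\<lambda>\<gamma>. (1/2) \<cdot>\<^sub>m node_ratio M \<gamma>) (node_ratio M) (BR1 M)"
  fix k \<gamma> assume a: "k \<in> elems M" "\<gamma> \<in> dir_facets M k"
  note adj = adj_dir_facet[OF a]
  then have k: "k \<in> adj M \<gamma>" by simp
  note Bc = B_carrier[OF k] and Uc = Upsilon_carrier[OF k]
  have d: "Upsilon M \<gamma> \<gamma> k = mat_diag (nf M) (\<lambda>i. Upsilon M \<gamma> \<gamma> k $$ (i,i))"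
    using Upsilon_same_facet(1)[of k \<gamma>] k by (simp add: adj_def)
  have "Upsilon M \<gamma> \<gamma> k $$ (i,l) = 0" if "i < nf M" "l < nf M" "i \<noteq> l" for i l
    by (subst d) (use that in \<open>simp add: mat_diag_def\<close>)
  then have "(1 / alpha M \<gamma> k) \<cdot>\<^sub>m Upsilon M \<gamma> \<gamma> k
      = mat_diag (nf M) (\<lambda>i. \<Sum>j\<in>adj M \<gamma>. Upsilon M \<gamma> \<gamma> j $$ (i,i) / alpha M \<gamma> j)"
    unfolding adj using Uc by (intro eq_matI) (auto simp: mat_diag_def)
  then have "node_ratio M \<gamma> * (B M \<gamma> * ((1 / alpha M \<gamma> k) \<cdot>\<^sub>m Upsilon M \<gamma> \<gamma> k) * B M \<gamma>)
    = (lambda_max (Lambda M k) * trace_const M \<gamma> k / alpha M \<gamma> k) \<cdot>\<^sub>m B M \<gamma>"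
    using node_ratio_mult[of \<gamma> "(1 / alpha M \<gamma> k) \<cdot>\<^sub>m Upsilon M \<gamma> \<gamma> k"] unfolding adj by simp
  \<comment> \<open>In \<open>TD\<close> the facet weight stands outside the product, whereas the
    cancellation has it next to \<Upsilon>.\<close>
  moreover have "B M \<gamma> * ((1 / alpha M \<gamma> k) \<cdot>\<^sub>m Upsilon M \<gamma> \<gamma> k) * B M \<gamma>
    = (1 / alpha M \<gamma> k) \<cdot>\<^sub>m (B M \<gamma> * Upsilon M \<gamma> \<gamma> k * B M \<gamma>)"
    using Bc Uc by (simp add: mult_smult_assoc_mat[of _ "nf M" "nf M"] mult_smult_distrib[of _ "nf M" "nf M"])
  ultimately show "TD ?C \<gamma> k = TD (SIPG M) \<gamma> k"
    by (simp add: scale_SAT_def BR1_def BR2_def SIPG_def)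
qed (simp add: scale_SAT_def BR1_def BR2_def SIPG_def extended_terms_zero)

end

text \<open>The SIPG factors are diagonal matrices because \<Upsilon> may vary along a facet. The
  scalar clause concerns \<open>B * Upsilon\<close>, as this is the matrix that turns
  \<open>B\<close> into \<open>B * Upsilon * B\<close>. Positivity of its scalars is implied: the
  factors have positive diagonals and \<open>nf M\<close> is positive.\<close>

theorem theorem9:
  fixes M :: "('e, 'f) disc"
  assumes "sbp_discretization M" and "R0_family M"
  shows
    "(\<exists>s1 > 0. \<exists>sD > 0.
        same_SAT M (scale_SAT (\<lambda>_. s1 \<cdot>\<^sub>m 1\<^sub>m (nf M)) (\<lambda>_. sD \<cdot>\<^sub>m 1\<^sub>m (nf M)) (BR1 M)) (BR2 M))
   \<and> (\<exists>\<sigma>1 \<sigma>D. (\<forall>\<gamma>. pos_diag (nf M) (\<sigma>1 \<gamma>) \<and> pos_diag (nf M) (\<sigma>D \<gamma>))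
        \<and> same_SAT M (scale_SAT \<sigma>1 \<sigma>D (BR1 M)) (SIPG M)
        \<and> (\<forall>\<gamma>. (\<forall>k \<in> adj M \<gamma>. \<exists>c. B M \<gamma> * Upsilon M \<gamma> \<gamma> k = c \<cdot>\<^sub>m 1\<^sub>m (nf M)) \<longrightarrow>
               (\<exists>s1 sD. \<sigma>1 \<gamma> = s1 \<cdot>\<^sub>m 1\<^sub>m (nf M) \<and> \<sigma>D \<gamma> = sD \<cdot>\<^sub>m 1\<^sub>m (nf M))))
   \<and> (\<forall>\<beta>. switch M \<beta> \<longrightarrow> (\<exists>s1 > 0. \<exists>sD > 0.
        same_SAT M (scale_SAT (\<lambda>_. s1 \<cdot>\<^sub>m 1\<^sub>m (nf M)) (\<lambda>_. sD \<cdot>\<^sub>m 1\<^sub>m (nf M)) (LDG M \<beta>)) (CDG M \<beta>)))"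
proof (intro conjI allI impI)
  show "\<exists>s1 > 0. \<exists>sD > 0.
      same_SAT M (scale_SAT (\<lambda>_. s1 \<cdot>\<^sub>m 1\<^sub>m (nf M)) (\<lambda>_. sD \<cdot>\<^sub>m 1\<^sub>m (nf M)) (BR1 M)) (BR2 M)"
    using same_SAT_BR1_BR2[OF assms] by (intro exI[of _ "1/2"] exI[of _ 1] conjI) simp_all
  show "\<exists>s1 > 0. \<exists>sD > 0.
      same_SAT M (scale_SAT (\<lambda>_. s1 \<cdot>\<^sub>m 1\<^sub>m (nf M)) (\<lambda>_. sD \<cdot>\<^sub>m 1\<^sub>m (nf M)) (LDG M \<beta>)) (CDG M \<beta>)" for \<beta>
    using same_SAT_LDG_CDG[OF assms] by (intro exI[of _ "1/2"] exI[of _ 1] conjI) simp_all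
  \<comment> \<open>Half of a scalar matrix is scalar, so one property of the ratio serves both
    factors.\<close>
  have scalar: "\<exists>s1 sD. (1/2) \<cdot>\<^sub>m node_ratio M \<gamma> = s1 \<cdot>\<^sub>m 1\<^sub>m (nf M) \<and> node_ratio M \<gamma> = sD \<cdot>\<^sub>m 1\<^sub>m (nf M)"
    if scal: "\<forall>k \<in> adj M \<gamma>. \<exists>c. B M \<gamma> * Upsilon M \<gamma> \<gamma> k = c \<cdot>\<^sub>m 1\<^sub>m (nf M)" for \<gamma>
  proof -
    obtain s where s: "node_ratio M \<gamma> = s \<cdot>\<^sub>m 1\<^sub>m (nf M)"
      using node_ratio_scalar[OF assms scal] by blast
    then have "(1/2) \<cdot>\<^sub>m node_ratio M \<gamma> = (s/2) \<cdot>\<^sub>m 1\<^sub>m (nf M)" by auto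
    with s show ?thesis by blast
  qed
  have pos: "pos_diag (nf M) (node_ratio M \<gamma>)" "pos_diag (nf M) ((1/2) \<cdot>\<^sub>m node_ratio M \<gamma>)" for \<gamma>
    using node_ratio_pos_diag[OF assms, of \<gamma>] by (auto simp: pos_diag_def diagonal_mat_def)
  show "\<exists>\<sigma>1 \<sigma>D. (\<forall>\<gamma>. pos_diag (nf M) (\<sigma>1 \<gamma>) \<and> pos_diag (nf M) (\<sigma>D \<gamma>))
      \<and> same_SAT M (scale_SAT \<sigma>1 \<sigma>D (BR1 M)) (SIPG M)
      \<and> (\<forall>\<gamma>. (\<forall>k \<in> adj M \<gamma>. \<exists>c. B M \<gamma> * Upsilon M \<gamma> \<gamma> k = c \<cdot>\<^sub>m 1\<^sub>m (nf M)) \<longrightarrow>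
             (\<exists>s1 sD. \<sigma>1 \<gamma> = s1 \<cdot>\<^sub>m 1\<^sub>m (nf M) \<and> \<sigma>D \<gamma> = sD \<cdot>\<^sub>m 1\<^sub>m (nf M)))"
    using same_SAT_BR1_SIPG[OF assms] scalar pos
    by (intro exI[of _ "\<lambda>\<gamma>. (1/2) \<cdot>\<^sub>m node_ratio M \<gamma>"] exI[of _ "node_ratio M"] conjI) blast+
qed

end
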